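(* Let $q$ be a prime power, $n\ge 1$ an integer, and $V$ an $n$-dimensional vector space over $\mathbb{F}_q$. Then \[ \mathrm{La}_{q}^{*}(n,\{\mathrm{V},\Lambda\}) = \begin{bmatrix} n\\ \lfloor n/2\rfloor\end{bmatrix}_q . \] Moreover, a family of subspaces of $V$ containing neither $\mathrm{V}$ nor $\Lambda$ as an induced subposet and having this maximum size is either the set of all $\lfloor n/2\rfloor$-dimensional subspaces of $V$ or the set of all $\lceil n/2\rceil$-dimensional subspaces of $V$, except in the case $n=3$, $q=2$, where there are exactly two further extremal families: fixing three $1$-dimensional subspaces $a,b,c$ of $V$ with $a+b+c=V$, these are (1) the three $2$-dimensional subspaces $a+b$, $a+c$, $b+c$ together with the four $1$-dimensional subspaces of $V$ other than $a,b,c$; and (2) the three $1$-dimensional subspaces $a,b,c$ together with the four $2$-dimensional subspaces of $V$ other than $a+b$, $a+c$, $b+c$.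
   Context: Subspaces of $V$ are ordered by inclusion. A poset $P$ is an induced subposet of a poset $Q$ if there is an injection $\phi:P\to Q$ with $x\le_P y \iff \phi(x)\le_Q\phi(y)$. $\mathrm{V}$ is the poset on $\{x,y,z\}$ with $x,y>z$ (and $x,y$ incomparable); $\Lambda$ is the poset on $\{x,y,z\}$ with $x,y<z$. $\mathrm{La}^*_q(n,\mathcal{P})$ is the maximum size of a family of subspaces of an $n$-dimensional vector space over $\mathbb{F}_q$ that contains no member of $\mathcal{P}$ as an induced subposet. $\begin{bmatrix} n\\ k\end{bmatrix}_q=\prod_{0\le i<k}\frac{q^{n-i}-1}{q^{k-i}-1}$ is the $q$-binomial coefficient (the number of $k$-dimensional subspaces). In the exceptional case $n=3,q=2$ the description of the two extra families is the one depicted in the paper's figure.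
   Formalization: n≥2 replaces n≥1 (for n=1 the family {0,V} has size 2>1); the uniqueness claim excludes n=q=2 (a chain {0,U,V} also has size 3); "exactly two further" families is read as all families (1),(2) over all a,b,c, forming two classes up to linear automorphism of V. *)

theory Defs
  imports
    Complex_Main
    "HOL-Library.Set_Algebras"
    "HOL-Number_Theory.Prime_Powers"
begin

text \<open>A poset is given by its carrier together with its order relation.\<close>

type_synonym 'p poset = "'p set \<times> ('p \<Rightarrow> 'p \<Rightarrow> bool)"

definition induced_subposet :: "'p poset \<Rightarrow> 'r poset \<Rightarrow> bool" where
  "induced_subposet P Q \<longleftrightarrow>
     (\<exists>\<phi>. inj_on \<phi> (fst P) \<and> \<phi> ` fst P \<subseteq> fst Q \<and>
          (\<forall>x\<in>fst P. \<forall>y\<in>fst P. snd P x y \<longleftrightarrow> snd Q (\<phi> x) (\<phi> y)))"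

datatype xyz = X | Y | Z

definition V_poset :: "xyz poset" where
  "V_poset = (UNIV, \<lambda>s t. s = t \<or> s = Z)"

definition Lambda_poset :: "xyz poset" where
  "Lambda_poset = (UNIV, \<lambda>s t. s = t \<or> t = Z)"

definition qbinomial :: "nat \<Rightarrow> nat \<Rightarrow> nat \<Rightarrow> real" where
  "qbinomial q n k = (\<Prod>i<k. (real q ^ (n - i) - 1) / (real q ^ (k - i) - 1))"

definition subspaces_of_dim ::
    "('a::field \<Rightarrow> 'b::ab_group_add \<Rightarrow> 'b) \<Rightarrow> nat \<Rightarrow> 'b set set" where
  "subspaces_of_dim scale k = {U. module.subspace scale U \<and> vector_space.dim scale U = k}"

definition free_family ::
    "('a::field \<Rightarrow> 'b::ab_group_add \<Rightarrow> 'b) \<Rightarrow> 'p poset set \<Rightarrow> 'b set set \<Rightarrow> bool" where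
  "free_family scale \<P> F \<longleftrightarrow>
     (\<forall>U\<in>F. module.subspace scale U) \<and> (\<forall>P\<in>\<P>. \<not> induced_subposet P (F, (\<subseteq>)))"

text \<open>
  The ambient space is the whole type \<open>'b\<close>. If it is finite, then so is the set of
  families over which the maximum is taken.
\<close>

definition La_star ::
    "('a::field \<Rightarrow> 'b::ab_group_add \<Rightarrow> 'b) \<Rightarrow> 'p poset set \<Rightarrow> nat" where
  "La_star scale \<P> = Max {card F | F. free_family scale \<P> F}"

definition extremal_family ::
    "('a::field \<Rightarrow> 'b::ab_group_add \<Rightarrow> 'b) \<Rightarrow> 'p poset set \<Rightarrow> 'b set set \<Rightarrow> bool" where
  "extremal_family scale \<P> F \<longleftrightarrow> free_family scale \<P> F \<and> card F = La_star scale \<P>"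

text \<open>
  Below, \<open>a + b\<close> is the elementwise sum of sets, which for subspaces is their sum.
\<close>

definition extra_family1 ::
    "('a::field \<Rightarrow> 'b::ab_group_add \<Rightarrow> 'b) \<Rightarrow> 'b set \<Rightarrow> 'b set \<Rightarrow> 'b set \<Rightarrow> 'b set set" where
  "extra_family1 scale a b c = {a + b, a + c, b + c} \<union> (subspaces_of_dim scale 1 - {a, b, c})"

definition extra_family2 ::
    "('a::field \<Rightarrow> 'b::ab_group_add \<Rightarrow> 'b) \<Rightarrow> 'b set \<Rightarrow> 'b set \<Rightarrow> 'b set \<Rightarrow> 'b set set" where
  "extra_family2 scale a b c = {a, b, c} \<union> (subspaces_of_dim scale 2 - {a + b, a + c, b + c})"

text \<open>
  Families are counted up to linear automorphisms of the ambient space: different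
  choices of \<open>a, b, c\<close> give different, but equivalent, families.
\<close>

definition equivalent_families ::
    "('a::field \<Rightarrow> 'b::ab_group_add \<Rightarrow> 'b) \<Rightarrow> 'b set set \<Rightarrow> 'b set set \<Rightarrow> bool" where
  "equivalent_families scale F G \<longleftrightarrow>
     (\<exists>g. Vector_Spaces.linear scale scale g \<and> bij g \<and> G = (\<lambda>U. g ` U) ` F)"

end

theory Submission
  imports Defs
begin

text \<open>
  In a free family any two members that are comparable to a common third member are comparable,
  so the family is a disjoint union of mutually incomparable chains. Averaging
  over full flags is too weak to bound it: for odd \<open>n\<close> too few flags meet a chain of two subspaces
  in the middle levels. Instead one averages over the linear images of a fat flag, in which the part
  between dimensions \<open>d\<close> and \<open>d + 3\<close>, with \<open>d + 1 = n div 2\<close>, is the full interval \<open>[U, W]\<close>, a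
  projective plane of order \<open>q\<close>. A family that meets the fat flag outside this interval meets it
  in a chain, which is too light. Otherwise it yields points and lines of the plane whose
  incidences form a matching, and second moments of the line intersections bound their number by
  \<open>q\<^sup>2 + q + 1\<close>; equality with both points and lines present forces \<open>q = 2\<close> and a triangle.

  In the case of equality all these intervals are extremal. For even \<open>n\<close> the unequal sizes of the
  levels \<open>d + 1\<close> and \<open>d + 2\<close> leave only points. For odd \<open>n \<ge> 5\<close> a double count inside intervals of
  rank 4 excludes mixed planes, also for \<open>q = 2\<close>, and adjacency of subspaces carries the
  conclusion to the whole level.
\<close>

section \<open>Sparse sets of points and lines in a projective plane\<close>

text \<open>Each level carries a total weight equal to its size, shared equally by the members of
  the fat flag in that level. Averaging over all linear images then gives exactly
  \<open>card F\<close>, so it suffices to bound the weight of one image. On an ordinary flag with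
  \<open>n\<close> odd, a pair from the two middle levels would weigh twice the target; inside the
  plane each of the two counts only 1/(q^2 + q + 1) <= 1/7 of its level. A chain through all levels
  then weighs at most 20/21 (odd \<open>n\<close>) or 6/7 (even \<open>n\<close>) of the target.
  Points and lines can coexist at the bound of the plane only if there are at most 2q of each, so
  q^2 + q + 1 <= 4q, which leaves q = 2. The rank limits the method: with rank 3 the interval does
  not fit into n = 2, which is treated by hand; with rank 4 it needs d + 4 <= 2d + 3, so n = 3 keeps
  its exceptional families. The rank 4 count succeeds even for q = 2 because the incidences, added
  over all planes, are still those of one matching.\<close>

lemma sum_card_incidences:
  assumes "finite S" "finite L" "\<And>p. p \<in> S \<Longrightarrow> card {l \<in> L. R p l} = r"
  shows "(\<Sum>l\<in>L. card {p \<in> S. R p l}) = card S * r"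
  using sum_multicount[of L S "\<lambda>l p. R p l" r] assms by (simp add: mult.commute)

text \<open>The square counts ordered pairs of members of \<open>S\<close> incident with
  \<open>l\<close>; summed over \<open>l\<close>, a diagonal pair contributes \<open>r\<close> and
  any other pair \<open>k\<close>. Planes use \<open>k = 1\<close>, intervals of rank 4 use
  \<open>k = q + 1\<close>.\<close>

lemma sum_card_incidences_square:
  assumes fin: "finite S" "finite L"
    and one: "\<And>p. p \<in> S \<Longrightarrow> card {l \<in> L. R p l} = r"
    and two: "\<And>p p'. p \<in> S \<Longrightarrow> p' \<in> S \<Longrightarrow> p \<noteq> p' \<Longrightarrow> card {l \<in> L. R p l \<and> R p' l} = k"
  shows "(\<Sum>l\<in>L. (card {p \<in> S. R p l})\<^sup>2) = card S * r + card S * (card S - 1) * k"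
proof -
  have "(\<Sum>l\<in>L. (card {p \<in> S. R p l})\<^sup>2) =
      (\<Sum>l\<in>L. card {z \<in> S \<times> S. R (fst z) l \<and> R (snd z) l})"
  proof (rule sum.cong[OF refl])
    fix l
    have "{z \<in> S \<times> S. R (fst z) l \<and> R (snd z) l} = {p \<in> S. R p l} \<times> {p \<in> S. R p l}"
      by auto
    then show "(card {p \<in> S. R p l})\<^sup>2 = card {z \<in> S \<times> S. R (fst z) l \<and> R (snd z) l}"
      by (simp add: card_cartesian_product power2_eq_square)
  qed
  also have "\<dots> = (\<Sum>z\<in>S \<times> S. if fst z = snd z then r else k)"
    using fin one two by (intro sum_multicount_gen) auto
  also have "\<dots> = (\<Sum>p\<in>S. \<Sum>p'\<in>S. if p = p' then r else k)"
    by (simp add: sum.cartesian_product case_prod_beta)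
  also have "\<dots> = (\<Sum>p\<in>S. r + (card S - 1) * k)"
  proof (rule sum.cong[OF refl])
    fix p assume p: "p \<in> S"
    have "(\<Sum>p'\<in>S - {p}. if p = p' then r else k) = (\<Sum>p'\<in>S - {p}. k)"
      by (rule sum.cong) auto
    then have "(\<Sum>p'\<in>S. if p = p' then r else k) = r + (\<Sum>p'\<in>S - {p}. k)"
      using p fin by (subst sum.remove[of _ p]) auto
    then show "(\<Sum>p'\<in>S. if p = p' then r else k) = r + (card S - 1) * k"
      using p fin by simp
  qed
  finally show ?thesis by (simp add: algebra_simps)
qed

section \<open>Projective planes of order q and their sparse pairs\<close>

locale projective_plane =
  fixes P :: "'p set" and L :: "'l set" and inc :: "'p \<Rightarrow> 'l \<Rightarrow> bool" and q :: nat
  assumes finite_points: "finite P" and finite_lines: "finite L"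
    and order_ge_2: "q \<ge> 2"
    and card_points: "card P = q\<^sup>2 + q + 1" and card_lines: "card L = q\<^sup>2 + q + 1"
    and points_on_line: "l \<in> L \<Longrightarrow> card {p \<in> P. inc p l} = q + 1"
    and lines_through_point: "p \<in> P \<Longrightarrow> card {l \<in> L. inc p l} = q + 1"
    and line_through_points:
      "p \<in> P \<Longrightarrow> p' \<in> P \<Longrightarrow> p \<noteq> p' \<Longrightarrow> card {l \<in> L. inc p l \<and> inc p' l} = 1"
    and point_on_lines:
      "l \<in> L \<Longrightarrow> l' \<in> L \<Longrightarrow> l \<noteq> l' \<Longrightarrow> card {p \<in> P. inc p l \<and> inc p l'} = 1"
begin

lemma dual: "projective_plane L P (\<lambda>l p. inc p l) q"
  by unfold_locales
    (simp_all add: finite_points finite_lines order_ge_2 card_points card_lines points_on_line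
      lines_through_point line_through_points point_on_lines)

text \<open>
  A line with \<open>x\<close> points in \<open>S\<close> contributes the nonnegative integer \<open>(x - q) * (x - q - 1)\<close>.
  Shifting by \<open>q\<close> makes this vanish in the extremal configurations.
\<close>

lemma sparse_identity:
  assumes S: "S \<subseteq> P" and T: "T \<subseteq> L" and sparse: "\<And>l. l \<in> T \<Longrightarrow> card {p \<in> S. inc p l} \<le> 1"
  defines "x \<equiv> \<lambda>l. int (card {p \<in> S. inc p l})"
  shows "int (card S) * int (card T) + (\<Sum>l\<in>L - T. (x l - int q) * (x l - int q - 1)) =
    2 * int q * (\<Sum>l\<in>T. x l)
      + (int (card S) + int (card T) - (int q ^ 2 + int q + 1)) * (int (card S) - int q ^ 2 - int q)"
proof -
  define s t e where "s = int (card S)" and "t = int (card T)" and "e = (\<Sum>l\<in>T. x l)"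
  have SP: "p \<in> P" if "p \<in> S" for p
    using S that by blast
  have finS: "finite S" and finT: "finite T"
    using S T finite_points finite_lines finite_subset by blast+
  have "(\<Sum>l\<in>L. card {p \<in> S. inc p l}) = card S * (q + 1)"
    using finS finite_lines S lines_through_point by (intro sum_card_incidences) auto
  then have "int (\<Sum>l\<in>L. card {p \<in> S. inc p l}) = int (card S * (q + 1))"
    by simp
  then have sum1: "(\<Sum>l\<in>L. x l) = s * (int q + 1)"
    by (simp add: x_def s_def algebra_simps)
  have "(\<Sum>l\<in>L. (card {p \<in> S. inc p l})\<^sup>2) = card S * (q + 1) + card S * (card S - 1) * 1"
    using SP lines_through_point line_through_points
    by (intro sum_card_incidences_square[OF finS finite_lines]) auto
  then have "int (\<Sum>l\<in>L. (card {p \<in> S. inc p l})\<^sup>2) =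
      int (card S * (q + 1)) + int (card S * (card S - 1))"
    by (simp only: of_nat_add mult_1_right)
  also have "int (card S * (card S - 1)) = s * (s - 1)"
    by (cases "card S") (simp_all add: s_def algebra_simps)
  also have "int (card S * (q + 1)) = s * (int q + 1)"
    by (simp add: s_def algebra_simps)
  finally have sum2: "(\<Sum>l\<in>L. (x l)\<^sup>2) = s * (s + int q)"
    by (simp add: x_def algebra_simps)
  \<comment> \<open>Sparsity enters here: on \<open>T\<close> the count is 0 or 1, so it equals its
    square and the single number \<open>e\<close> gives both moments.\<close>
  have sumT2: "(\<Sum>l\<in>T. (x l)\<^sup>2) = e"
    unfolding e_def
  proof (rule sum.cong[OF refl])
    fix l assume "l \<in> T"
    then have "card {p \<in> S. inc p l} = 0 \<or> card {p \<in> S. inc p l} = 1"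
      using sparse by fastforce
    then show "(x l)\<^sup>2 = x l" unfolding x_def by auto
  qed
  have c: "int (card (L - T)) = int q ^ 2 + int q + 1 - t"
    using T finT card_lines card_mono[OF finite_lines T]
    by (simp add: card_Diff_subset t_def of_nat_diff)
  have "(\<Sum>l\<in>L - T. (x l - int q) * (x l - int q - 1)) =
     (\<Sum>l\<in>L - T. (x l)\<^sup>2) - (2 * int q + 1) * (\<Sum>l\<in>L - T. x l)
       + int q * (int q + 1) * int (card (L - T))"
    by (simp add: sum_distrib_left power2_eq_square algebra_simps sum.distrib sum_subtractf)
  also have "(\<Sum>l\<in>L - T. (x l)\<^sup>2) = s * (s + int q) - e"
    using sum_diff[OF finite_lines T, of "\<lambda>l. (x l)\<^sup>2"] sum2 sumT2 by simp
  also have "(\<Sum>l\<in>L - T. x l) = s * (int q + 1) - e"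
    using sum_diff[OF finite_lines T, of x] sum1 e_def by simp
  finally have A: "(\<Sum>l\<in>L - T. (x l - int q) * (x l - int q - 1)) =
      s * (s + int q) - e - (2 * int q + 1) * (s * (int q + 1) - e)
       + int q * (int q + 1) * (int q ^ 2 + int q + 1 - t)"
    unfolding c .
  show ?thesis
    unfolding A s_def[symmetric] t_def[symmetric] e_def[symmetric] by algebra
qed

end

text \<open>Restricting a free family to the points and lines of a plane gives such a pair: Lambda
  forbids two points of \<open>S\<close> on a line of \<open>T\<close>, and V forbids two lines of
  \<open>T\<close> through a point of \<open>S\<close>.\<close>

locale sparse_pair = projective_plane P L inc q
  for P :: "'p set" and L :: "'l set" and inc q +
  fixes S :: "'p set" and T :: "'l set"
  assumes S_sub: "S \<subseteq> P" and T_sub: "T \<subseteq> L"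
    and few_points: "l \<in> T \<Longrightarrow> card {p \<in> S. inc p l} \<le> 1"
    and few_lines: "p \<in> S \<Longrightarrow> card {l \<in> T. inc p l} \<le> 1"
begin

abbreviation "incidences \<equiv> \<Sum>l\<in>T. card {p \<in> S. inc p l}"

lemma finite_S: "finite S" and finite_T: "finite T"
  using S_sub T_sub finite_points finite_lines finite_subset by blast+

lemma dual_pair: "sparse_pair L P (\<lambda>l p. inc p l) q T S"
proof -
  interpret d: projective_plane L P "\<lambda>l p. inc p l" q by (rule dual)
  show ?thesis by unfold_locales (use S_sub T_sub few_points few_lines in auto)
qed

lemma incidences_dual: "incidences = (\<Sum>p\<in>S. card {l \<in> T. inc p l})"
  using sum.swap_restrict[OF finite_T finite_S, of "\<lambda>_ _. 1 :: nat" "\<lambda>l p. inc p l"]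
  by simp

lemma incidences_le_T: "incidences \<le> card T"
  using sum_mono[of T "\<lambda>l. card {p \<in> S. inc p l}" "\<lambda>_. 1"] few_points by simp

lemma incidences_le_S: "incidences \<le> card S"
  using sum_mono[of S "\<lambda>l. card {p \<in> T. inc l p}" "\<lambda>_. 1"] few_lines
  unfolding incidences_dual by simp

text \<open>A line of \<open>T\<close> has \<open>q + 1 >= 3\<close> points but at most one of them
  in \<open>S\<close>, so \<open>S\<close> misses a point. This fixes the sign of the last factor in
  \<open>product_le\<close>.\<close>

lemma card_S_le:
  assumes "T \<noteq> {}"
  shows "card S \<le> q\<^sup>2 + q"
proof (rule ccontr)
  assume "\<not> ?thesis"
  then have "S = P"
    using card_seteq[OF finite_points S_sub] card_points by simp
  moreover obtain l where "l \<in> T" using assms by blast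
  ultimately show False
    using few_points[of l] points_on_line[of l] T_sub order_ge_2 by auto
qed

lemma identity:
  "int (card S) * int (card T)
    + (\<Sum>l\<in>L - T. (int (card {p \<in> S. inc p l}) - int q) * (int (card {p \<in> S. inc p l}) - int q - 1)) =
    2 * int q * int incidences
      + (int (card S) + int (card T) - (int q ^ 2 + int q + 1)) * (int (card S) - int q ^ 2 - int q)"
  using sparse_identity[OF S_sub T_sub few_points] by simp

lemma consecutive_product_nonneg: "(x - y) * (x - y - 1) \<ge> 0" for x y :: int
  by (cases "x - y \<le> 0") (simp_all add: mult_nonpos_nonpos)

lemma product_le:
  "int (card S) * int (card T) \<le> 2 * int q * int incidences
      + (int (card S) + int (card T) - (int q ^ 2 + int q + 1)) * (int (card S) - int q ^ 2 - int q)"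
proof -
  have "(\<Sum>l\<in>L - T. (int (card {p \<in> S. inc p l}) - int q) * (int (card {p \<in> S. inc p l}) - int q - 1)) \<ge> 0"
    by (intro sum_nonneg consecutive_product_nonneg)
  then show ?thesis using identity by linarith
qed

text \<open>Once the total reaches the bound, the product term of \<open>product_le\<close> is
  nonpositive by \<open>card_S_le\<close>. What is left is |S| |T| <= 2q e with e <= |S|, and |S|
  cancels. The dual pair bounds \<open>card S\<close> in the same way.\<close>

lemma other_le:
  assumes "S \<noteq> {}" "T \<noteq> {}" "card S + card T \<ge> q\<^sup>2 + q + 1"
  shows "card T \<le> 2 * q"
proof -
  have "int (card S) \<le> int q ^ 2 + int q"
    using card_S_le[OF assms(2)] by (simp flip: of_nat_add of_nat_power)
  moreover have "int (card S) + int (card T) \<ge> int q ^ 2 + int q + 1"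
    using assms(3) by (simp flip: of_nat_add of_nat_power of_nat_Suc)
  ultimately have "(int (card S) + int (card T) - (int q ^ 2 + int q + 1))
      * (int (card S) - int q ^ 2 - int q) \<le> 0"
    by (intro mult_nonneg_nonpos) auto
  with product_le have "int (card S) * int (card T) \<le> 2 * int q * int incidences" by linarith
  also have "\<dots> \<le> 2 * int q * int (card S)"
    using incidences_le_S by (intro mult_left_mono) (simp_all del: of_nat_sum)
  finally have "int (card S) * int (card T) \<le> int (card S) * (2 * int q)" by (simp add: mult_ac)
  moreover have "int (card S) > 0" using assms(1) finite_S by (simp add: card_gt_0_iff)
  ultimately have "int (card T) \<le> 2 * int q" by (simp only: mult_le_cancel_left_pos)
  then show ?thesis by simp
qed

end

lemma (in sparse_pair) mixed_imp:
  assumes ne: "S \<noteq> {}" "T \<noteq> {}" and ge: "card S + card T \<ge> q\<^sup>2 + q + 1"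
  shows "q = 2" "card S = 3 \<and> card T = 4 \<or> card S = 4 \<and> card T = 3" "incidences = 3"
proof -
  interpret d: sparse_pair L P "\<lambda>l p. inc p l" q T S by (rule dual_pair)
  have le: "card T \<le> 2 * q" "card S \<le> 2 * q"
    using other_le[OF ne ge] d.other_le[OF ne(2,1)] ge by (simp_all add: add.commute)
  \<comment> \<open>Both sizes are at most \<open>2 * q\<close>, so the total is at most
    \<open>4 * q\<close>, which is below q^2 + q + 1 as soon as \<open>q >= 3\<close>.\<close>
  have "q < 3"
  proof (rule ccontr)
    assume "\<not> ?thesis"
    then have "q * q \<ge> 3 * q" by simp
    then show False using le ge unfolding power2_eq_square by linarith
  qed
  then show q: "q = 2" using order_ge_2 by simp
  have p: "int (card S) * int (card T) \<le> 4 * int incidences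
      + (int (card S) + int (card T) - 7) * (int (card S) - 6)"
    using product_le q by simp
  \<comment> \<open>With \<open>q = 2\<close> only the sizes 3 and 4 remain. The pair (4, 4) would
    need 16 <= 4e - 2 with e <= 4; a pair of total 7 needs 12 <= 4e with e <= 3, so e = 3.\<close>
  have s: "card S = 3 \<or> card S = 4" "card T = 3 \<or> card T = 4" "card S + card T \<ge> 7"
    using le ge q by auto
  from p have "int (card S * card T) \<le> int (4 * incidences)
      + (int (card S) + int (card T) - 7) * (int (card S) - 6)"
    by simp
  with s incidences_le_S incidences_le_T
  show "card S = 3 \<and> card T = 4 \<or> card S = 4 \<and> card T = 3" "incidences = 3"
    by (auto simp del: of_nat_sum of_nat_mult)
qed

context sparse_pair
begin

lemma card_le: "card S + card T \<le> q\<^sup>2 + q + 1"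
proof (cases "S = {} \<or> T = {}")
  case True
  then show ?thesis
    using card_mono[OF finite_points S_sub] card_mono[OF finite_lines T_sub] card_points card_lines
    by auto
next
  case False
  then show ?thesis
    using mixed_imp by (cases "card S + card T \<ge> q\<^sup>2 + q + 1") auto
qed

text \<open>At the exact bound the product term vanishes. Keeping \<open>incidences\<close> instead
  of estimating it allows the inequality to be added up over many planes.\<close>

lemma product_le_incidences:
  assumes "card S + card T = q\<^sup>2 + q + 1"
  shows "card S * card T \<le> 2 * q * incidences"
proof -
  have "int (card S) + int (card T) = int q ^ 2 + int q + 1"
    using assms by (simp flip: of_nat_add of_nat_power of_nat_Suc)
  then have "int (card S) * int (card T) \<le> 2 * int q * int incidences"
    using product_le by simp
  then have "int (card S * card T) \<le> int (2 * q * incidences)" by simp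
  then show ?thesis by (simp only: of_nat_le_iff)
qed

text \<open>With \<open>q = 2\<close>, sizes 3 and 4 and 3 incidences, the identity reads 12 + sum =
  12, so every line outside \<open>T\<close> has 2 or 3 points of \<open>S\<close>. Of the 3 * 3 = 9
  incidences of \<open>S\<close> with all lines, 6 fall on these three lines, hence 2 on
  each.\<close>

lemma mixed_complement:
  assumes "T \<noteq> {}" "card S + card T = q\<^sup>2 + q + 1" "card S = 3" "l \<in> L"
  shows "l \<notin> T \<longleftrightarrow> card {p \<in> S. inc p l} = 2"
proof
  assume "card {p \<in> S. inc p l} = 2"
  then show "l \<notin> T" using few_points[of l] by auto
next
  assume l: "l \<notin> T"
  have "S \<noteq> {}" using assms by auto
  note m = mixed_imp[OF this assms(1) eq_refl[OF assms(2)[symmetric]]]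
  define x where "x = (\<lambda>l. int (card {p \<in> S. inc p l}))"
  have "(\<Sum>l\<in>L - T. (x l - 2) * (x l - 3)) = 0"
    using identity assms m(1) m(2) m(3) by (auto simp: x_def)
  then have zero: "\<forall>l\<in>L - T. (x l - 2) * (x l - 3) = 0"
    using finite_lines consecutive_product_nonneg[of _ 2]
    by (subst (asm) sum_nonneg_eq_0_iff) auto
  have "(\<Sum>l\<in>L. card {p \<in> S. inc p l}) = card S * (q + 1)"
    using finite_S finite_lines S_sub lines_through_point by (intro sum_card_incidences) auto
  then have "(\<Sum>l\<in>L - T. card {p \<in> S. inc p l}) = 6"
    using m assms T_sub finite_lines by (subst (asm) sum.subset_diff[of T]) auto
  then have "int (\<Sum>l\<in>L - T. card {p \<in> S. inc p l}) = 6" by simp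
  then have "(\<Sum>l\<in>L - T. x l) = 6" by (simp add: x_def)
  moreover have "card (L - T) = 3"
    using m assms T_sub finite_T card_lines by (auto simp: card_Diff_subset)
  ultimately have "(\<Sum>l\<in>L - T. x l - 2) = 0" by (simp add: sum_subtractf)
  moreover have "\<forall>l\<in>L - T. x l - 2 \<ge> 0" using zero by force
  ultimately have "\<forall>l\<in>L - T. x l - 2 = 0"
    using finite_lines by (subst (asm) sum_nonneg_eq_0_iff) auto
  then show "card {p \<in> S. inc p l} = 2" using l assms by (auto simp: x_def)
qed

end

section \<open>Subspaces of a finite vector space\<close>

locale finite_geometry = finite_dimensional_vector_space scale Basis
  for scale :: "'a::{field,finite} \<Rightarrow> 'b::ab_group_add \<Rightarrow> 'b" (infixr "*s" 75)
    and Basis :: "'b set" +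
  fixes q n :: nat
  assumes card_field: "card (UNIV :: 'a set) = q" and card_Basis: "card Basis = n"
begin

abbreviation level :: "nat \<Rightarrow> 'b set set" where "level \<equiv> subspaces_of_dim scale"

text \<open>The index is the absolute dimension, so the points and lines of the interval [U, W] have
  the indices \<open>dim U + 1\<close> and \<open>dim U + 2\<close>.\<close>

definition between :: "'b set \<Rightarrow> 'b set \<Rightarrow> nat \<Rightarrow> 'b set set" where
  "between U W i = {A \<in> level i. U \<subseteq> A \<and> A \<subseteq> W}"

lemma level_iff: "A \<in> level i \<longleftrightarrow> subspace A \<and> dim A = i"
  by (simp add: subspaces_of_dim_def)

lemma between_iff: "A \<in> between U W i \<longleftrightarrow> subspace A \<and> dim A = i \<and> U \<subseteq> A \<and> A \<subseteq> W"
  by (auto simp: between_def level_iff)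

lemma q_ge_2: "q \<ge> 2"
proof -
  have "card {0, 1 :: 'a} \<le> card (UNIV :: 'a set)" by (rule card_mono) auto
  then show ?thesis by (simp add: card_field)
qed

lemma card_span_independent:
  assumes "finite B" "independent B"
  shows "card (span B) = q ^ card B"
  using assms
proof (induction B)
  case empty
  then show ?case by simp
next
  case (insert b B)
  have ind: "independent B" and b: "b \<notin> span B"
    using insert by (auto simp: independent_insert)
  let ?f = "\<lambda>(k, x). k *s b + x"
  have "span (insert b B) = ?f ` (UNIV \<times> span B)"
  proof (intro subset_antisym subsetI)
    fix y assume "y \<in> span (insert b B)"
    then obtain k where "y - k *s b \<in> span B" by (auto simp: span_breakdown_eq)
    then show "y \<in> ?f ` (UNIV \<times> span B)"
      by (intro image_eqI[of _ _ "(k, y - k *s b)"]) auto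
  next
    fix y assume "y \<in> ?f ` (UNIV \<times> span B)"
    then obtain k x where "y = k *s b + x" "x \<in> span B" by auto
    then show "y \<in> span (insert b B)"
      unfolding span_breakdown_eq by (intro exI[of _ k]) simp
  qed
  moreover have "inj_on ?f (UNIV \<times> span B)"
  proof (rule inj_onI, clarify)
    fix k x k' x' assume x: "x \<in> span B" "x' \<in> span B" and eq: "k *s b + x = k' *s b + x'"
    then have e: "(k - k') *s b = x' - x" by (simp add: algebra_simps)
    have "k = k'"
    proof (rule ccontr)
      assume "k \<noteq> k'"
      then have "b = inverse (k - k') *s (x' - x)" by (simp flip: e)
      then show False using b x by (metis span_diff span_scale)
    qed
    then show "k = k' \<and> x = x'" using eq by simp
  qed
  ultimately have "card (span (insert b B)) = q * card (span B)"
    by (simp add: card_image card_cartesian_product card_field)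
  then show ?case using insert ind by simp
qed

lemma card_subspace:
  assumes "subspace U"
  shows "card U = q ^ dim U"
proof -
  obtain B where "B \<subseteq> U" "independent B" "U \<subseteq> span B" "card B = dim U"
    using basis_exists by blast
  then show ?thesis
    using card_span_independent[of B] finiteI_independent span_subspace assms by metis
qed

lemma finite_UNIV_vectors: "finite (UNIV :: 'b set)"
  using card_subspace[OF subspace_UNIV] q_ge_2 by (intro card_ge_0_finite) simp

lemma span_of_subspace [simp]: "subspace A \<Longrightarrow> span A = A"
  by simp

lemma finite_vectors [simp, intro]: "finite (A :: 'b set)"
  by (rule finite_subset[OF subset_UNIV finite_UNIV_vectors])

lemma finite_vector_sets [simp, intro]: "finite (A :: 'b set set)"
  by (rule finite_subset[of _ "Pow UNIV"]) (auto simp: finite_UNIV_vectors finite_Pow_iff simp del: Pow_UNIV)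

lemma finite_level: "finite (level i)" by simp

lemma dim_le_n: "dim A \<le> n"
  using dim_subset_UNIV[of A] by (simp add: dimension_def card_Basis)

lemma subspace_eqI: "subspace A \<Longrightarrow> subspace B \<Longrightarrow> A \<subseteq> B \<Longrightarrow> dim B \<le> dim A \<Longrightarrow> A = B"
  by (rule subspace_dim_equal)

lemma level_antichain:
  assumes "A \<in> level i" "B \<in> level i" "A \<subseteq> B"
  shows "A = B"
  using assms subspace_eqI by (auto simp: level_iff)

lemma level_0: "level 0 = {{0}}"
proof -
  have "A \<in> level 0 \<longleftrightarrow> A = {0}" for A
    unfolding level_iff dim_eq_0 using subspace_0[of A] by auto
  then show ?thesis by blast
qed

lemma level_n: "level n = {UNIV}"
proof -
  have "A = UNIV" if "subspace A" "dim A = n" for A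
    using that subspace_eqI[of A UNIV] by (simp add: card_Basis)
  moreover have "dim UNIV = n" by (simp add: card_Basis)
  ultimately show ?thesis unfolding level_iff set_eq_iff by auto
qed

lemma plus_eq_span: "subspace A \<Longrightarrow> subspace B \<Longrightarrow> A + B = span (A \<union> B)"
  unfolding span_Un set_plus_def by auto

lemma subspace_plus: "subspace A \<Longrightarrow> subspace B \<Longrightarrow> subspace (A + B)"
  by (simp add: plus_eq_span)

lemma plus_upper:
  assumes "subspace A" "subspace B"
  shows "A \<subseteq> A + B" "B \<subseteq> A + B"
  using assms span_superset[of "A \<union> B"] by (auto simp: plus_eq_span)

lemma plus_least: "subspace A \<Longrightarrow> subspace B \<Longrightarrow> subspace C \<Longrightarrow> A \<subseteq> C \<Longrightarrow> B \<subseteq> C \<Longrightarrow> A + B \<subseteq> C"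
  by (simp add: plus_eq_span span_minimal)

lemma dim_plus:
  assumes "subspace A" "subspace B"
  shows "dim (A + B) + dim (A \<inter> B) = dim A + dim B"
proof -
  have "A + B = {x + y |x y. x \<in> A \<and> y \<in> B}" by (auto simp: set_plus_def)
  then show ?thesis using dim_sums_Int[OF assms] by simp
qed

lemma dim_insert_notin: "subspace A \<Longrightarrow> x \<notin> A \<Longrightarrow> dim (insert x A) = Suc (dim A)"
  by (simp add: dim_insert)

section \<open>Intervals of small rank as projective geometries\<close>

lemma card_between_Suc:
  assumes U: "subspace U" and W: "subspace W" and UW: "U \<subseteq> W" and d: "dim W = dim U + r"
  shows "card (between U W (Suc (dim U))) = (\<Sum>i<r. q ^ i)"
proof -
  let ?B = "between U W (Suc (dim U))"
  \<comment> \<open>The sets \<open>A - U\<close> partition \<open>W - U\<close>, since a vector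
    outside \<open>U\<close> spans together with \<open>U\<close> exactly one member; each has
    q^(dim U + 1) - q^(dim U) elements.\<close>
  have un: "W - U = (\<Union>A\<in>?B. A - U)"
  proof (intro subset_antisym subsetI)
    fix x assume x: "x \<in> W - U"
    have "span (insert x U) \<in> ?B"
      using x U W UW span_superset[of "insert x U"] span_minimal[of "insert x U" W]
      by (auto simp: between_iff dim_insert_notin)
    then show "x \<in> (\<Union>A\<in>?B. A - U)"
      using x span_superset[of "insert x U"] by blast
  qed (auto simp: between_iff)
  have "(A - U) \<inter> (A' - U) = {}" if A: "A \<in> ?B" "A' \<in> ?B" "A \<noteq> A'" for A A'
  proof (rule ccontr)
    assume "\<not> ?thesis"
    then obtain x where x: "x \<in> A" "x \<in> A'" "x \<notin> U" by blast
    have "span (insert x U) = C" if "C \<in> ?B" "x \<in> C" for C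
      using that x U by (intro subspace_eqI) (auto simp: between_iff dim_insert_notin span_minimal)
    then show False using A x by metis
  qed
  then have "card (W - U) = (\<Sum>A\<in>?B. card (A - U))"
    unfolding un by (intro card_UN_disjoint) auto
  also have "\<dots> = (\<Sum>A\<in>?B. q ^ Suc (dim U) - q ^ dim U)"
    using U by (intro sum.cong) (auto simp: between_iff card_Diff_subset card_subspace)
  finally have "q ^ (dim U + r) - q ^ dim U = card ?B * (q ^ Suc (dim U) - q ^ dim U)"
    using U W UW d by (simp add: card_Diff_subset card_subspace)
  \<comment> \<open>Integers avoid truncated subtraction while q^(dim U) and q - 1 are
    cancelled.\<close>
  then have "int (q ^ (dim U + r) - q ^ dim U) = int (card ?B * (q ^ Suc (dim U) - q ^ dim U))"
    by (rule arg_cong)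
  moreover have "q ^ dim U \<le> q ^ (dim U + r)" "q ^ dim U \<le> q ^ Suc (dim U)"
    using q_ge_2 by (intro power_increasing; simp)+
  then have "int (q ^ (dim U + r) - q ^ dim U) = int q ^ dim U * (int q ^ r - 1)"
    "int (q ^ Suc (dim U) - q ^ dim U) = int q ^ dim U * (int q - 1)"
    by (simp_all add: of_nat_diff algebra_simps power_add)
  ultimately have "int q ^ dim U * (int q ^ r - 1) = int q ^ dim U * (int (card ?B) * (int q - 1))"
    by (simp only: of_nat_mult mult_ac)
  then have "int q ^ r - 1 = int (card ?B) * (int q - 1)"
    using q_ge_2 by simp
  moreover have "int q ^ r - 1 = (int q - 1) * (\<Sum>i<r. int q ^ i)"
    by (rule power_diff_1_eq)
  ultimately have "(int q - 1) * int (card ?B) = (int q - 1) * (\<Sum>i<r. int q ^ i)"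
    by (metis mult.commute)
  then have "int (card ?B) = (\<Sum>i<r. int q ^ i)"
    using q_ge_2 by (subst (asm) mult_left_cancel) auto
  then have "int (card ?B) = int (\<Sum>i<r. q ^ i)" by simp
  then show ?thesis by (simp only: of_nat_eq_iff)
qed

lemma card_points_rank2:
  assumes "subspace U" "subspace W" "U \<subseteq> W" "dim W = dim U + 2"
  shows "card (between U W (Suc (dim U))) = q + 1"
  using card_between_Suc[OF assms] by (simp add: numeral_2_eq_2)

lemma card_points_rank3:
  assumes "subspace U" "subspace W" "U \<subseteq> W" "dim W = dim U + 3"
  shows "card (between U W (Suc (dim U))) = q\<^sup>2 + q + 1"
  using card_between_Suc[OF assms] by (simp add: numeral_3_eq_3 power2_eq_square)

lemma card_points_rank4:
  assumes "subspace U" "subspace W" "U \<subseteq> W" "dim W = dim U + 4"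
  shows "card (between U W (Suc (dim U))) = q ^ 3 + q\<^sup>2 + q + 1"
  using card_between_Suc[OF assms] by (simp add: eval_nat_numeral)

lemma inter_points:
  assumes U: "subspace U" and A: "A \<in> between U W (Suc (dim U))" "A' \<in> between U W (Suc (dim U))"
    and ne: "A \<noteq> A'"
  shows "A \<inter> A' = U" "dim (A + A') = dim U + 2"
proof -
  have sub: "subspace A" "subspace A'" "U \<subseteq> A" "U \<subseteq> A'" "dim A = Suc (dim U)" "dim A' = Suc (dim U)"
    using A by (auto simp: between_iff)
  have "A \<inter> A' \<noteq> A"
    using ne sub subspace_eqI[of A A'] by auto
  then have "dim (A \<inter> A') \<noteq> Suc (dim U)"
    using subspace_eqI[of "A \<inter> A'" A] sub by (auto simp: subspace_inter)
  moreover have "dim (A \<inter> A') \<le> Suc (dim U)"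
    using dim_subset[of "A \<inter> A'" A] sub by auto
  ultimately have "dim (A \<inter> A') \<le> dim U" by simp
  then show *: "A \<inter> A' = U"
    using subspace_eqI[of U "A \<inter> A'"] sub U by (auto simp: subspace_inter)
  then show "dim (A + A') = dim U + 2"
    using dim_plus[of A A'] sub by simp
qed

lemma lines_through_points_eq:
  assumes U: "subspace U" and W: "subspace W"
    and A: "A \<in> between U W (Suc (dim U))" "A' \<in> between U W (Suc (dim U))" "A \<noteq> A'"
  shows "{B \<in> between U W (dim U + 2). A \<subseteq> B \<and> A' \<subseteq> B} = {A + A'}"
proof -
  have sub: "subspace A" "subspace A'" "U \<subseteq> A" "A \<subseteq> W" "A' \<subseteq> W"
    using A by (auto simp: between_iff)
  have d: "dim (A + A') = dim U + 2" using inter_points(2)[OF U A] .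
  have "A + A' = B" if "subspace B" "dim B = dim U + 2" "A \<subseteq> B" "A' \<subseteq> B" for B
    using that sub d plus_least[of A A' B] by (intro subspace_eqI) (auto simp: subspace_plus)
  then show ?thesis
    using sub d W plus_upper[of A A'] plus_least[of A A' W]
    by (auto simp: between_iff subspace_plus)
qed

text \<open>Two distinct lines together span all of \<open>W\<close>, so the dimension formula
  leaves \<open>dim U + 1\<close> for their intersection.\<close>

lemma inter_lines:
  assumes U: "subspace U" and W: "subspace W" "dim W = dim U + 3"
    and B: "B \<in> between U W (dim U + 2)" "B' \<in> between U W (dim U + 2)" "B \<noteq> B'"
  shows "{A \<in> between U W (Suc (dim U)). A \<subseteq> B \<and> A \<subseteq> B'} = {B \<inter> B'}" 
proof -
  have sub: "subspace B" "subspace B'" "U \<subseteq> B" "U \<subseteq> B'" "B \<subseteq> W" "B' \<subseteq> W"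
    "dim B = dim U + 2" "dim B' = dim U + 2"
    using B by (auto simp: between_iff)
  have "B + B' \<noteq> B"
    using B(3) sub subspace_eqI[of B' B] plus_upper(2)[of B B'] by auto
  then have "dim (B + B') \<noteq> dim U + 2"
    using subspace_eqI[of B "B + B'"] sub plus_upper(1)[of B B'] by (auto simp: subspace_plus)
  moreover have "dim U + 2 \<le> dim (B + B')"
    using dim_subset[OF plus_upper(1)[of B B']] sub by auto
  moreover have "dim (B + B') \<le> dim U + 3"
    using dim_subset[OF plus_least[of B B' W]] sub W by auto
  ultimately have "dim (B + B') = dim U + 3" by linarith
  then have d: "dim (B \<inter> B') = Suc (dim U)" using dim_plus[of B B'] sub by simp
  have "A = B \<inter> B'" if "subspace A" "dim A = Suc (dim U)" "A \<subseteq> B" "A \<subseteq> B'" for A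
    using that sub d by (intro subspace_eqI) (auto simp: subspace_inter)
  then show ?thesis
    using sub d by (auto simp: between_iff subspace_inter)
qed

lemma projective_plane_between:
  assumes U: "subspace U" and W: "subspace W" and UW: "U \<subseteq> W" and d: "dim W = dim U + 3"
  shows "projective_plane (between U W (Suc (dim U))) (between U W (dim U + 2)) (\<subseteq>) q"
proof -
  let ?P = "between U W (Suc (dim U))" and ?L = "between U W (dim U + 2)"
  have cP: "card ?P = q\<^sup>2 + q + 1"
    using card_points_rank3[OF assms] .
  have pl: "card {A \<in> ?P. A \<subseteq> B} = q + 1" if B: "B \<in> ?L" for B
  proof -
    have "{A \<in> ?P. A \<subseteq> B} = between U B (Suc (dim U))"
      using B by (intro set_eqI, simp add: between_iff) (metis subset_trans)
    then show ?thesis using card_points_rank2[of U B] B U by (auto simp: between_iff)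
  qed
  have lp: "card {B \<in> ?L. A \<subseteq> B} = q + 1" if A: "A \<in> ?P" for A
  proof -
    have "{B \<in> ?L. A \<subseteq> B} = between A W (Suc (dim A))"
      using A by (intro set_eqI, simp add: between_iff) (metis subset_trans)
    then show ?thesis using card_points_rank2[of A W] A W d by (auto simp: between_iff)
  qed
  \<comment> \<open>Counting incident pairs from both sides, with \<open>q + 1\<close> on either
    side, transfers the number of points to the lines.\<close>
  have "(\<Sum>B\<in>?L. card {A \<in> ?P. A \<subseteq> B}) = card ?P * (q + 1)"
    using lp by (intro sum_card_incidences) auto
  then have "card ?L * (q + 1) = card ?P * (q + 1)"
    using pl by simp
  then have cL: "card ?L = q\<^sup>2 + q + 1" using cP by (metis Suc_eq_plus1 mult_cancel2 nat.distinct(1))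
  show ?thesis
  proof
    show "card {B \<in> ?L. A \<subseteq> B \<and> A' \<subseteq> B} = 1" if "A \<in> ?P" "A' \<in> ?P" "A \<noteq> A'" for A A'
      unfolding lines_through_points_eq[OF U W that] by simp
    show "card {A \<in> ?P. A \<subseteq> B \<and> A \<subseteq> B'} = 1" if "B \<in> ?L" "B' \<in> ?L" "B \<noteq> B'" for B B'
      unfolding inter_lines[OF U W d that] by simp
  qed (use cP cL pl lp q_ge_2 in simp_all)
qed

lemma card_lines_rank3:
  assumes "subspace U" "subspace W" "U \<subseteq> W" "dim W = dim U + 3"
  shows "card (between U W (dim U + 2)) = q\<^sup>2 + q + 1"
  using projective_plane.card_lines[OF projective_plane_between[OF assms]] .


subsection \<open>Counting subspaces\<close>

text \<open>These are the ordered bases when \<open>W\<close> has dimension \<open>k\<close>.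
  Independence of \<open>set xs\<close> does not see repetitions, hence
  \<open>distinct\<close>.\<close>

definition indep_lists :: "'b set \<Rightarrow> nat \<Rightarrow> 'b list set" where
  "indep_lists W k = {xs. length xs = k \<and> distinct xs \<and> independent (set xs) \<and> set xs \<subseteq> W}"

lemma finite_indep_lists: "finite (indep_lists W k)"
proof (rule finite_subset)
  show "indep_lists W k \<subseteq> {xs. set xs \<subseteq> UNIV \<and> length xs = k}"
    by (auto simp: indep_lists_def)
qed (rule finite_lists_length_eq[OF finite_UNIV_vectors])

text \<open>Lists grow at the head, where the new vector has to avoid the span of the tail. For
  \<open>k > dim W\<close> the factor \<open>i = dim W\<close> is 0, as it should be.\<close>

lemma card_indep_lists:
  assumes W: "subspace W"
  shows "card (indep_lists W k) = (\<Prod>i<k. q ^ dim W - q ^ i)"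
proof (induction k)
  case 0
  have "indep_lists W 0 = {[]}" by (auto simp: indep_lists_def independent_empty)
  then show ?case by simp
next
  case (Suc k)
  have un: "indep_lists W (Suc k) = (\<Union>xs\<in>indep_lists W k. (\<lambda>x. x # xs) ` (W - span (set xs)))"
  proof (intro subset_antisym subsetI)
    fix ys assume "ys \<in> indep_lists W (Suc k)"
    then obtain x xs where "ys = x # xs" "x \<in> W - span (set xs)" "xs \<in> indep_lists W k"
      by (cases ys) (auto simp: indep_lists_def independent_insert split: if_splits)
    then show "ys \<in> (\<Union>xs\<in>indep_lists W k. (\<lambda>x. x # xs) ` (W - span (set xs)))" by blast
  next
    fix ys assume "ys \<in> (\<Union>xs\<in>indep_lists W k. (\<lambda>x. x # xs) ` (W - span (set xs)))"
    then obtain x xs where "ys = x # xs" and x: "x \<in> W" "x \<notin> span (set xs)" and xs: "xs \<in> indep_lists W k"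
      by auto
    moreover have "independent (insert x (set xs))"
      using x xs by (intro independent_insertI) (auto simp: indep_lists_def)
    ultimately show "ys \<in> indep_lists W (Suc k)"
      by (auto simp: indep_lists_def span_base)
  qed
  have "card ((\<lambda>x. x # xs) ` (W - span (set xs))) = q ^ dim W - q ^ k"
    if "xs \<in> indep_lists W k" for xs
  proof -
    have xs: "independent (set xs)" "set xs \<subseteq> W" "card (set xs) = k"
      using that by (auto simp: indep_lists_def distinct_card)
    have "card (span (set xs)) = q ^ k" using card_span_independent[of "set xs"] xs by simp
    moreover have "span (set xs) \<subseteq> W" using xs W by (simp add: span_minimal)
    ultimately have "card (W - span (set xs)) = q ^ dim W - q ^ k"
      using card_subspace[OF W] by (simp add: card_Diff_subset)
    then show ?thesis by (subst card_image) (auto simp: inj_on_def)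
  qed
  moreover have "card (indep_lists W (Suc k)) =
      (\<Sum>xs\<in>indep_lists W k. card ((\<lambda>x. x # xs) ` (W - span (set xs))))"
    unfolding un by (rule card_UN_disjoint) (auto simp: finite_indep_lists)
  ultimately have "card (indep_lists W (Suc k)) = card (indep_lists W k) * (q ^ dim W - q ^ k)"
    by simp
  then show ?case using Suc by simp
qed

text \<open>An independent list of length \<open>k\<close> is an ordered basis of exactly one
  \<open>k\<close>-dimensional subspace, its span. Grouping the lists by span gives the
  product.\<close>

lemma card_level_mult:
  "card (level k) * (\<Prod>i<k. q ^ k - q ^ i) = (\<Prod>i<k. q ^ n - q ^ i)"
proof -
  have "indep_lists UNIV k = (\<Union>A\<in>level k. indep_lists A k)"
  proof (intro subset_antisym subsetI)
    fix xs assume xs: "xs \<in> indep_lists UNIV k"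
    then have "span (set xs) \<in> level k"
      by (auto simp: level_iff indep_lists_def dim_eq_card_independent distinct_card)
    moreover have "xs \<in> indep_lists (span (set xs)) k"
      using xs by (auto simp: indep_lists_def span_base)
    ultimately show "xs \<in> (\<Union>A\<in>level k. indep_lists A k)" by blast
  qed (auto simp: indep_lists_def)
  moreover have "indep_lists A k \<inter> indep_lists A' k = {}"
    if "A \<in> level k" "A' \<in> level k" "A \<noteq> A'" for A A'
  proof (rule ccontr)
    assume "\<not> ?thesis"
    then obtain xs where xs: "xs \<in> indep_lists A k" "xs \<in> indep_lists A' k" by blast
    have "span (set xs) = C" if "xs \<in> indep_lists C k" "C \<in> level k" for C
      using that by (intro subspace_eqI)
        (auto simp: indep_lists_def level_iff dim_eq_card_independent distinct_card span_minimal)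
    then show False using xs that by metis
  qed
  ultimately have "card (indep_lists UNIV k) = (\<Sum>A\<in>level k. card (indep_lists A k))"
    using finite_indep_lists by (simp add: card_UN_disjoint)
  then show ?thesis
    by (simp add: card_indep_lists level_iff card_Basis)
qed

lemma power_q_less: "i < j \<Longrightarrow> q ^ i < q ^ j"
  using q_ge_2 by (intro power_strict_increasing) auto

lemma card_level_qbinomial:
  assumes "k \<le> n"
  shows "real (card (level k)) = qbinomial q n k"
proof -
  \<comment> \<open>After this factorization the powers q^i cancel in each quotient, which leaves
    the factors of \<open>qbinomial\<close>.\<close>
  have r: "real (q ^ m - q ^ i) = real q ^ i * (real q ^ (m - i) - 1)" if "i < m" for i m
    using power_q_less[OF that] that
    by (simp add: of_nat_diff right_diff_distrib flip: power_add)
  have "real (card (level k)) * (\<Prod>i<k. real (q ^ k - q ^ i)) = (\<Prod>i<k. real (q ^ n - q ^ i))"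
    using arg_cong[OF card_level_mult[of k], of real] by simp
  moreover have pos: "(\<Prod>i<k. real (q ^ k - q ^ i)) \<noteq> 0"
    using power_q_less[of _ k] by (simp add: prod_zero_iff) (meson lessThan_iff not_le)
  ultimately have "real (card (level k)) = (\<Prod>i<k. real (q ^ n - q ^ i) / real (q ^ k - q ^ i))"
    by (simp add: prod_dividef field_simps)
  also have "\<dots> = (\<Prod>i<k. (real q ^ (n - i) - 1) / (real q ^ (k - i) - 1))"
  proof (rule prod.cong[OF refl])
    fix i assume "i \<in> {..<k}"
    then have "real (q ^ n - q ^ i) = real q ^ i * (real q ^ (n - i) - 1)"
      "real (q ^ k - q ^ i) = real q ^ i * (real q ^ (k - i) - 1)"
      using assms by (simp_all only: r lessThan_iff)
    then show "real (q ^ n - q ^ i) / real (q ^ k - q ^ i) = (real q ^ (n - i) - 1) / (real q ^ (k - i) - 1)"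
      using q_ge_2 by (simp only:) simp
  qed
  finally show ?thesis by (simp add: qbinomial_def)
qed

text \<open>The ratio of consecutive Gaussian binomials, from which all later comparisons of level
  sizes are derived.\<close>

lemma card_level_Suc:
  assumes "i < n"
  shows "card (level (Suc i)) * (q ^ Suc i - 1) = card (level i) * (q ^ (n - i) - 1)"
proof -
  define C where "C = (\<Prod>j<i. q ^ i - q ^ j)"
  have C: "C * q ^ i \<noteq> 0"
    using power_q_less[of _ i] q_ge_2 by (simp add: C_def prod_zero_iff)
  \<comment> \<open>The factor \<open>j = 0\<close> splits off; every other factor yields one
    \<open>q\<close> and turns into a factor of \<open>C\<close>.\<close>
  have "(\<Prod>j<Suc i. q ^ Suc i - q ^ j) = (q ^ Suc i - 1) * (\<Prod>j<i. q * (q ^ i - q ^ j))"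
    by (subst prod.lessThan_Suc_shift) (simp add: diff_mult_distrib2)
  also have "\<dots> = (q ^ Suc i - 1) * (C * q ^ i)"
    by (simp add: prod.distrib C_def mult.commute)
  finally have 1: "(\<Prod>j<Suc i. q ^ Suc i - q ^ j) = (q ^ Suc i - 1) * (C * q ^ i)" .
  have "card (level (Suc i)) * (\<Prod>j<Suc i. q ^ Suc i - q ^ j) = (\<Prod>j<i. q ^ n - q ^ j) * (q ^ n - q ^ i)"
    unfolding card_level_mult by simp
  also have "\<dots> = card (level i) * C * (q ^ n - q ^ i)"
    unfolding C_def card_level_mult ..
  also have "q ^ n - q ^ i = q ^ i * (q ^ (n - i) - 1)"
    using assms by (simp add: diff_mult_distrib2 flip: power_add)
  finally have "card (level (Suc i)) * (q ^ Suc i - 1) * (C * q ^ i)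
      = card (level i) * (q ^ (n - i) - 1) * (C * q ^ i)"
    unfolding 1 by (simp only: mult_ac)
  then show ?thesis using C by (simp only: mult_cancel2) simp
qed

lemma level_nonempty: "i \<le> n \<Longrightarrow> level i \<noteq> {}"
  using choose_subspace_of_subspace[of i UNIV] unfolding level_iff[abs_def] dim_UNIV card_Basis
  by (metis empty_iff level_iff)

lemma card_level_pos: "i \<le> n \<Longrightarrow> card (level i) > 0"
  using level_nonempty by (simp add: card_gt_0_iff)

subsection \<open>Averaging over the general linear group\<close>

definition GL :: "('b \<Rightarrow> 'b) set" where
  "GL = {g. Vector_Spaces.linear scale scale g \<and> bij g}"

lemma finite_GL: "finite GL"
proof -
  have "finite (UNIV :: ('b \<Rightarrow> 'b) set)"
    using finite_set_of_finite_funs[OF finite_UNIV_vectors finite_UNIV_vectors] by simp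
  then show ?thesis by (rule finite_subset[OF subset_UNIV])
qed

lemma id_in_GL: "id \<in> GL"
  by (simp add: GL_def linear_id)

lemma card_GL_pos: "card GL > 0"
  using finite_GL id_in_GL by (auto simp: card_gt_0_iff)

lemma GL_comp: "g \<in> GL \<Longrightarrow> h \<in> GL \<Longrightarrow> g \<circ> h \<in> GL"
  by (auto simp: GL_def intro: bij_comp Vector_Spaces.linear_compose)

lemma GL_image_subset_iff: "g \<in> GL \<Longrightarrow> g ` A \<subseteq> g ` B \<longleftrightarrow> A \<subseteq> B"
  by (auto simp: GL_def inj_image_subset_iff bij_is_inj)

lemma GL_image_eq_iff: "g \<in> GL \<Longrightarrow> g ` A = g ` B \<longleftrightarrow> A = B"
  by (auto simp: GL_def inj_image_eq_iff bij_is_inj)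

lemma inj_GL_image: "g \<in> GL \<Longrightarrow> inj_on (\<lambda>A. g ` A) F"
  by (simp add: inj_on_def GL_image_eq_iff)

lemma GL_subspace_image: 
  assumes "g \<in> GL" "subspace A"
  shows "subspace (g ` A)" "dim (g ` A) = dim A"
proof -
  have lin: "Vector_Spaces.linear scale scale g" and inj: "inj g"
    using assms by (auto simp: GL_def bij_is_inj)
  interpret g: Vector_Spaces.linear scale scale g by (rule lin)
  interpret p: finite_dimensional_vector_space_pair_1 scale Basis scale by unfold_locales
  show "subspace (g ` A)" by (rule g.subspace_image[OF assms(2)])
  show "dim (g ` A) = dim A"
    using p.dim_image_eq[OF lin, of A] inj by (meson inj_on_subset subset_UNIV)
qed

lemma GL_image_level: "g \<in> GL \<Longrightarrow> A \<in> level i \<Longrightarrow> g ` A \<in> level i"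
  using GL_subspace_image by (simp add: level_iff)

lemma extend_to_GL:
  assumes "independent B" "independent (f ` B)" "inj_on f B"
  obtains g where "g \<in> GL" "\<And>x. x \<in> B \<Longrightarrow> g x = f x"
proof -
  obtain g where g: "Vector_Spaces.linear scale scale g" "inj g" "\<forall>x\<in>B. g x = f x"
    using linear_independent_extend_inj[OF assms] by blast
  then have "bij g" using finite_UNIV_inj_surj[OF finite_UNIV_vectors] by (auto simp: bij_def)
  then show ?thesis using g that by (auto simp: GL_def)
qed

lemma GL_transitive:
  assumes "A \<in> level i" "B \<in> level i"
  obtains g where "g \<in> GL" "g ` A = B"
proof -
  obtain C where C: "C \<subseteq> A" "independent C" "A \<subseteq> span C" "card C = dim A"
    using basis_exists by blast
  obtain D where D: "D \<subseteq> B" "independent D" "B \<subseteq> span D" "card D = dim B"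
    using basis_exists by blast
  have "card C = card D" using C D assms by (simp add: level_iff)
  then obtain f where f: "bij_betw f C D"
    using finite_same_card_bij[of C D] by auto
  then obtain g where g: "g \<in> GL" "\<And>x. x \<in> C \<Longrightarrow> g x = f x"
    using extend_to_GL[of C f] C D by (auto simp: bij_betw_def)
  interpret g: Vector_Spaces.linear scale scale g using g by (simp add: GL_def)
  have "g ` A = g ` span C" using span_subspace[OF C(1,3)] assms by (simp add: level_iff)
  also have "\<dots> = span (g ` C)" by (simp add: g.span_image)
  also have "g ` C = D" using g f by (auto simp: bij_betw_def)
  also have "span D = B" using span_subspace[OF D(1,3)] assms by (simp add: level_iff)
  finally show ?thesis using g that by blast
qed

text \<open>Orbit counting: composition with a map taking \<open>C\<close> to \<open>D\<close>
  injects the maps that send \<open>A\<close> to \<open>C\<close> into those that send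
  \<open>A\<close> to \<open>D\<close>. By transitivity \<open>GL\<close> splits into equally large
  classes, one per target.\<close>

lemma card_GL_mapping:
  assumes A: "A \<in> level i" and B: "B \<in> level i"
  shows "card {g \<in> GL. g ` A = B} * card (level i) = card GL"
proof -
  have le: "card {g \<in> GL. g ` A = C} \<le> card {g \<in> GL. g ` A = D}"
    if C: "C \<in> level i" and D: "D \<in> level i" for C D
  proof -
    obtain h where h: "h \<in> GL" "h ` C = D" using GL_transitive[OF C D] .
    show ?thesis
    proof (rule card_inj_on_le[of "\<lambda>g. h \<circ> g"])
      show "inj_on (\<lambda>g. h \<circ> g) {g \<in> GL. g ` A = C}"
        using h by (intro inj_onI) (simp add: GL_def bij_is_inj fun.inj_map_strong inj_eq fun_eq_iff)
      show "(\<lambda>g. h \<circ> g) ` {g \<in> GL. g ` A = C} \<subseteq> {g \<in> GL. g ` A = D}"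
        using h by (auto simp: GL_comp image_comp[symmetric])
    qed (use finite_GL in simp)
  qed
  have eq: "card {g \<in> GL. g ` A = C} = card {g \<in> GL. g ` A = B}" if "C \<in> level i" for C
    using le[OF that B] le[OF B that] by simp
  have "GL = (\<Union>C\<in>level i. {g \<in> GL. g ` A = C})"
    using GL_image_level[OF _ A] by auto
  then have "card GL = (\<Sum>C\<in>level i. card {g \<in> GL. g ` A = C})"
    using finite_GL by (subst card_UN_disjoint[symmetric]) auto
  also have "\<dots> = card (level i) * card {g \<in> GL. g ` A = B}"
    using eq by simp
  finally show ?thesis by (simp add: mult.commute)
qed

lemma sum_by_level:
  assumes "\<And>A. A \<in> F \<Longrightarrow> subspace A"
  shows "(\<Sum>A\<in>F. f A) = (\<Sum>i\<le>n. \<Sum>A\<in>F \<inter> level i. f A)"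
proof -
  have "F = (\<Union>i\<in>{..n}. F \<inter> level i)" using assms dim_le_n by (auto simp: level_iff)
  then have "(\<Sum>A\<in>F. f A) = (\<Sum>A\<in>(\<Union>i\<in>{..n}. F \<inter> level i). f A)" by simp
  also have "\<dots> = (\<Sum>i\<le>n. \<Sum>A\<in>F \<inter> level i. f A)"
    by (rule sum.UNION_disjoint) (auto simp: level_iff)
  finally show ?thesis .
qed

text \<open>A random \<open>g\<close> sends a member of level \<open>i\<close> to a uniformly
  distributed one, so on average \<open>Q\<close> hits \<open>F\<close> in this level |Q_i| |F_i| /
  |level i| times, with Q_i and F_i the parts in level \<open>i\<close>. The hypothesis on
  \<open>w\<close> turns this into |F_i|.\<close>

lemma GL_average:
  fixes w :: "nat \<Rightarrow> real"
  assumes Q: "\<And>A. A \<in> Q \<Longrightarrow> subspace A" and F: "\<And>A. A \<in> F \<Longrightarrow> subspace A"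
    and w: "\<And>i. i \<le> n \<Longrightarrow> w i * card (Q \<inter> level i) = card (level i)"
  shows "(\<Sum>g\<in>GL. \<Sum>A\<in>{A \<in> Q. g ` A \<in> F}. w (dim A)) = card GL * card F"
proof -
  have c: "real (card {g \<in> GL. g ` A \<in> F}) = card GL * card (F \<inter> level i) / card (level i)"
    if A: "A \<in> level i" for A i
  proof -
    have pos: "card (level i) > 0" using A by (auto simp: card_gt_0_iff)
    have "{g \<in> GL. g ` A \<in> F} = (\<Union>B\<in>F \<inter> level i. {g \<in> GL. g ` A = B})"
      using GL_image_level[OF _ A] by auto
    then have "card {g \<in> GL. g ` A \<in> F} = (\<Sum>B\<in>F \<inter> level i. card {g \<in> GL. g ` A = B})"
      using finite_GL by (simp add: card_UN_disjoint disjoint_iff)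
    then have "card {g \<in> GL. g ` A \<in> F} * card (level i) = (\<Sum>B\<in>F \<inter> level i. card {g \<in> GL. g ` A = B} * card (level i))"
      by (simp add: sum_distrib_right)
    also have "\<dots> = (\<Sum>B\<in>F \<inter> level i. card GL)"
      using card_GL_mapping[OF A] by (intro sum.cong) auto
    finally have "card {g \<in> GL. g ` A \<in> F} * card (level i) = card GL * card (F \<inter> level i)"
      by simp
    then have "real (card {g \<in> GL. g ` A \<in> F}) * card (level i) = card GL * card (F \<inter> level i)"
      by (simp only: flip: of_nat_mult)
    then show ?thesis using pos by (intro eq_divide_imp) auto
  qed
  have "(\<Sum>g\<in>GL. \<Sum>A\<in>{A \<in> Q. g ` A \<in> F}. w (dim A)) = (\<Sum>A\<in>Q. \<Sum>g\<in>{g \<in> GL. g ` A \<in> F}. w (dim A))"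
    using finite_GL by (intro sum.swap_restrict) auto
  also have "\<dots> = (\<Sum>A\<in>Q. w (dim A) * card {g \<in> GL. g ` A \<in> F})"
    by (simp add: mult.commute)
  also have "\<dots> = (\<Sum>i\<le>n. \<Sum>A\<in>Q \<inter> level i. w (dim A) * card {g \<in> GL. g ` A \<in> F})"
    by (rule sum_by_level[OF Q])
  also have "\<dots> = (\<Sum>i\<le>n. real (card GL) * real (card (F \<inter> level i)))"
  proof (rule sum.cong[OF refl])
    fix i assume i: "i \<in> {..n}"
    have "(\<Sum>A\<in>Q \<inter> level i. w (dim A) * card {g \<in> GL. g ` A \<in> F}) =
      (\<Sum>A\<in>Q \<inter> level i. w i * (card GL * card (F \<inter> level i) / card (level i)))"
      by (rule sum.cong) (auto simp: c level_iff)
    also have "\<dots> = w i * card (Q \<inter> level i) * (card GL * card (F \<inter> level i) / card (level i))"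
      by simp
    also have "\<dots> = real (card GL) * real (card (F \<inter> level i))"
      using w[of i] card_level_pos[of i] i by simp
    finally show "(\<Sum>A\<in>Q \<inter> level i. w (dim A) * card {g \<in> GL. g ` A \<in> F}) =
      real (card GL) * real (card (F \<inter> level i))" .
  qed
  also have "\<dots> = card GL * card F"
    using sum_by_level[of F "\<lambda>_. 1 :: nat"] F by (simp flip: sum_distrib_left of_nat_sum)
  finally show ?thesis .
qed

end

section \<open>Families without induced V and Lambda\<close>

text \<open>If \<open>B\<close> and \<open>C\<close> are incomparable, both differ from a common
  lower bound \<open>A\<close>, so non-strict inclusions suffice to recover the injection.\<close>

lemma induced_V_iff:
  "induced_subposet V_poset (F, (\<subseteq>)) \<longleftrightarrow>
    (\<exists>A\<in>F. \<exists>B\<in>F. \<exists>C\<in>F. A \<subseteq> B \<and> A \<subseteq> C \<and> \<not> B \<subseteq> C \<and> \<not> C \<subseteq> B)"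
proof
  assume "induced_subposet V_poset (F, (\<subseteq>))"
  then obtain \<phi> where \<phi>: "range \<phi> \<subseteq> F" "\<And>s t. (s = t \<or> s = Z) \<longleftrightarrow> \<phi> s \<subseteq> \<phi> t"
    by (auto simp: induced_subposet_def V_poset_def)
  have "\<phi> Z \<subseteq> \<phi> X" "\<phi> Z \<subseteq> \<phi> Y" "\<not> \<phi> X \<subseteq> \<phi> Y" "\<not> \<phi> Y \<subseteq> \<phi> X"
    using \<phi>(2)[of Z X] \<phi>(2)[of Z Y] \<phi>(2)[of X Y] \<phi>(2)[of Y X] by simp_all
  then show "\<exists>A\<in>F. \<exists>B\<in>F. \<exists>C\<in>F. A \<subseteq> B \<and> A \<subseteq> C \<and> \<not> B \<subseteq> C \<and> \<not> C \<subseteq> B"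
    using \<phi>(1)
    by (intro bexI[of _ "\<phi> Z"] bexI[of _ "\<phi> X"] bexI[of _ "\<phi> Y"] conjI range_subsetD[OF \<phi>(1)])
next
  assume "\<exists>A\<in>F. \<exists>B\<in>F. \<exists>C\<in>F. A \<subseteq> B \<and> A \<subseteq> C \<and> \<not> B \<subseteq> C \<and> \<not> C \<subseteq> B"
  then obtain A B C where *: "A \<in> F" "B \<in> F" "C \<in> F" "A \<subseteq> B" "A \<subseteq> C" "\<not> B \<subseteq> C" "\<not> C \<subseteq> B"
    by blast
  define \<phi> where "\<phi> s = (case s of X \<Rightarrow> B | Y \<Rightarrow> C | Z \<Rightarrow> A)" for s
  have "inj \<phi>"
    using * by (auto simp: inj_def \<phi>_def split: xyz.splits)
  moreover have "range \<phi> \<subseteq> F"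
    using * by (auto simp: \<phi>_def split: xyz.splits)
  moreover have "(s = t \<or> s = Z) \<longleftrightarrow> \<phi> s \<subseteq> \<phi> t" for s t
    using * by (cases s; cases t) (auto simp: \<phi>_def)
  ultimately show "induced_subposet V_poset (F, (\<subseteq>))"
    by (auto simp: induced_subposet_def V_poset_def)
qed

lemma induced_Lambda_iff:
  "induced_subposet Lambda_poset (F, (\<subseteq>)) \<longleftrightarrow>
    (\<exists>A\<in>F. \<exists>B\<in>F. \<exists>C\<in>F. B \<subseteq> A \<and> C \<subseteq> A \<and> \<not> B \<subseteq> C \<and> \<not> C \<subseteq> B)"
proof
  assume "induced_subposet Lambda_poset (F, (\<subseteq>))"
  then obtain \<phi> where \<phi>: "range \<phi> \<subseteq> F" "\<And>s t. (s = t \<or> t = Z) \<longleftrightarrow> \<phi> s \<subseteq> \<phi> t"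
    by (auto simp: induced_subposet_def Lambda_poset_def)
  have "\<phi> X \<subseteq> \<phi> Z" "\<phi> Y \<subseteq> \<phi> Z" "\<not> \<phi> X \<subseteq> \<phi> Y" "\<not> \<phi> Y \<subseteq> \<phi> X"
    using \<phi>(2)[of X Z] \<phi>(2)[of Y Z] \<phi>(2)[of X Y] \<phi>(2)[of Y X] by simp_all
  then show "\<exists>A\<in>F. \<exists>B\<in>F. \<exists>C\<in>F. B \<subseteq> A \<and> C \<subseteq> A \<and> \<not> B \<subseteq> C \<and> \<not> C \<subseteq> B"
    using \<phi>(1)
    by (intro bexI[of _ "\<phi> Z"] bexI[of _ "\<phi> X"] bexI[of _ "\<phi> Y"] conjI range_subsetD[OF \<phi>(1)])
next
  assume "\<exists>A\<in>F. \<exists>B\<in>F. \<exists>C\<in>F. B \<subseteq> A \<and> C \<subseteq> A \<and> \<not> B \<subseteq> C \<and> \<not> C \<subseteq> B"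
  then obtain A B C where *: "A \<in> F" "B \<in> F" "C \<in> F" "B \<subseteq> A" "C \<subseteq> A" "\<not> B \<subseteq> C" "\<not> C \<subseteq> B"
    by blast
  define \<phi> where "\<phi> s = (case s of X \<Rightarrow> B | Y \<Rightarrow> C | Z \<Rightarrow> A)" for s
  have "inj \<phi>"
    using * by (auto simp: inj_def \<phi>_def split: xyz.splits)
  moreover have "range \<phi> \<subseteq> F"
    using * by (auto simp: \<phi>_def split: xyz.splits)
  moreover have "(s = t \<or> t = Z) \<longleftrightarrow> \<phi> s \<subseteq> \<phi> t" for s t
    using * by (cases s; cases t) (auto simp: \<phi>_def)
  ultimately show "induced_subposet Lambda_poset (F, (\<subseteq>))"
    by (auto simp: induced_subposet_def Lambda_poset_def)
qed

text \<open>The hypothesis says that r a(i+1) <= a(i) - a(i+1), and the right sides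
  telescope.\<close>

lemma geometric_decay_sum:
  fixes a :: "nat \<Rightarrow> real"
  assumes "\<And>i. i < p \<Longrightarrow> (r + 1) * a (Suc i) \<le> a i"
  shows "r * (\<Sum>i<p. a (Suc i)) \<le> a 0 - a p"
  using assms
proof (induction p)
  case (Suc p)
  then have "r * (\<Sum>i<p. a (Suc i)) \<le> a 0 - a p" "(r + 1) * a (Suc p) \<le> a p" by auto
  then show ?case by (simp add: algebra_simps)
qed simp

context finite_geometry
begin

abbreviation free :: "'b set set \<Rightarrow> bool" where
  "free \<equiv> free_family scale {V_poset, Lambda_poset}"

lemma free_iff:
  "free F \<longleftrightarrow> (\<forall>A\<in>F. subspace A) \<and>
    (\<forall>A\<in>F. \<forall>B\<in>F. \<forall>C\<in>F. A \<subseteq> B \<and> A \<subseteq> C \<longrightarrow> B \<subseteq> C \<or> C \<subseteq> B) \<and>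
    (\<forall>A\<in>F. \<forall>B\<in>F. \<forall>C\<in>F. B \<subseteq> A \<and> C \<subseteq> A \<longrightarrow> B \<subseteq> C \<or> C \<subseteq> B)"
  unfolding free_family_def by (simp add: induced_V_iff induced_Lambda_iff) meson

lemma free_subspace: "free F \<Longrightarrow> A \<in> F \<Longrightarrow> subspace A"
  by (simp add: free_iff)

lemma free_above: "free F \<Longrightarrow> A \<in> F \<Longrightarrow> B \<in> F \<Longrightarrow> C \<in> F \<Longrightarrow> A \<subseteq> B \<Longrightarrow> A \<subseteq> C \<Longrightarrow> B \<subseteq> C \<or> C \<subseteq> B"
  unfolding free_iff by blast

lemma free_below: "free F \<Longrightarrow> A \<in> F \<Longrightarrow> B \<in> F \<Longrightarrow> C \<in> F \<Longrightarrow> B \<subseteq> A \<Longrightarrow> C \<subseteq> A \<Longrightarrow> B \<subseteq> C \<or> C \<subseteq> B"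
  unfolding free_iff by blast

text \<open>If \<open>B\<close> and \<open>C\<close> lie on the same side of \<open>A\<close>, this
  is the exclusion of V or Lambda; on opposite sides inclusion is transitive.\<close>

lemma free_comparable:
  assumes "free F" "A \<in> F" "B \<in> F" "C \<in> F" "A \<subseteq> B \<or> B \<subseteq> A" "A \<subseteq> C \<or> C \<subseteq> A"
  shows "B \<subseteq> C \<or> C \<subseteq> B"
  using assms free_above[of F A B C] free_below[of F A B C] by (meson subset_trans)

lemma free_level: "free (level i)"
  unfolding free_iff
proof (intro conjI ballI impI)
  fix A B C assume *: "A \<in> level i" "B \<in> level i" "C \<in> level i"
  show "B \<subseteq> C \<or> C \<subseteq> B" if "A \<subseteq> B \<and> A \<subseteq> C"
    using level_antichain[of A i B] * that by auto
  show "B \<subseteq> C \<or> C \<subseteq> B" if "B \<subseteq> A \<and> C \<subseteq> A"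
    using level_antichain[of B i A] * that by auto
qed (simp add: level_iff)

text \<open>Converse of the passage from a free family to a sparse pair, used to check the
  exceptional families. Members of one level are incomparable, so a V or Lambda would have to cross
  the levels, which the two cardinality bounds exclude.\<close>

lemma free_two_levels:
  assumes S: "S \<subseteq> level i" and T: "T \<subseteq> level j" and ij: "i < j"
    and S1: "\<And>B. B \<in> T \<Longrightarrow> card {A \<in> S. A \<subseteq> B} \<le> 1"
    and T1: "\<And>A. A \<in> S \<Longrightarrow> card {B \<in> T. A \<subseteq> B} \<le> 1"
  shows "free (S \<union> T)"
proof -
  have lev: "subspace A \<and> dim A = i" if "A \<in> S" for A
    using S that by (auto simp: level_iff)
  have lev': "subspace A \<and> dim A = j" if "A \<in> T" for A
    using T that by (auto simp: level_iff)
  note lev = lev lev'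
  have down: "A = B" if "A \<in> T" "B \<in> S \<union> T" "A \<subseteq> B" for A B
  proof -
    have "dim A \<le> dim B" using that by (simp add: dim_subset)
    then show ?thesis using that lev ij level_antichain[of A j B] by (fastforce simp: level_iff)
  qed
  have up: "B = A" if "A \<in> S" "B \<in> S \<union> T" "B \<subseteq> A" for A B
  proof -
    have "dim B \<le> dim A" using that by (simp add: dim_subset)
    then show ?thesis using that lev ij level_antichain[of B i A] by (fastforce simp: level_iff)
  qed
  have uS: "B = C" if "B \<in> S" "C \<in> S" "A \<in> T" "B \<subseteq> A" "C \<subseteq> A" for A B C
    using card_le_Suc0_iff_eq[of "{B \<in> S. B \<subseteq> A}"] S1[of A] that by auto
  have uT: "B = C" if "B \<in> T" "C \<in> T" "A \<in> S" "A \<subseteq> B" "A \<subseteq> C" for A B C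
    using card_le_Suc0_iff_eq[of "{B \<in> T. A \<subseteq> B}"] T1[of A] that by auto
  have "B \<subseteq> C \<or> C \<subseteq> B"
    if "A \<in> S \<union> T" "B \<in> S \<union> T" "C \<in> S \<union> T" "A \<subseteq> B" "A \<subseteq> C" for A B C
  proof (cases "A \<in> T \<or> B \<in> S \<or> C \<in> S")
    case True
    then show ?thesis using that down[of A B] down[of A C] up[of B A] up[of C A] by (metis order_refl)
  next
    case False
    then show ?thesis using that uT[of B C A] by auto
  qed
  moreover have "B \<subseteq> C \<or> C \<subseteq> B"
    if "A \<in> S \<union> T" "B \<in> S \<union> T" "C \<in> S \<union> T" "B \<subseteq> A" "C \<subseteq> A" for A B C
  proof (cases "A \<in> S \<or> B \<in> T \<or> C \<in> T")
    case True
    then show ?thesis using that up[of A B] up[of A C] down[of B A] down[of C A] by (metis order_refl)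
  next
    case False
    then show ?thesis using that uS[of B C A] by auto
  qed
  moreover have "subspace A" if "A \<in> S \<union> T" for A using lev that by blast
  ultimately show ?thesis unfolding free_iff by (intro conjI ballI impI) simp_all
qed

text \<open>Pulling the family back along \<open>g\<close>, instead of moving the fat flag, keeps
  \<open>U\<close>, \<open>W\<close> and \<open>Q\<close> fixed in all estimates.\<close>

lemma free_vimage:
  assumes g: "g \<in> GL" and F: "free F"
  shows "free {A. subspace A \<and> g ` A \<in> F}"
proof -
  let ?G = "{A. subspace A \<and> g ` A \<in> F}"
  show ?thesis
    unfolding free_iff
  proof (intro conjI ballI impI)
    fix A B C assume *: "A \<in> ?G" "B \<in> ?G" "C \<in> ?G"
    show "B \<subseteq> C \<or> C \<subseteq> B" if "A \<subseteq> B \<and> A \<subseteq> C"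
      using free_above[OF F, of "g ` A" "g ` B" "g ` C"] * that by (simp add: GL_image_subset_iff[OF g])
    show "B \<subseteq> C \<or> C \<subseteq> B" if "B \<subseteq> A \<and> C \<subseteq> A"
      using free_below[OF F, of "g ` A" "g ` B" "g ` C"] * that by (simp add: GL_image_subset_iff[OF g])
  qed simp
qed

subsection \<open>Fat flags\<close>

lemma exists_chain:
  assumes "subspace U" "subspace W" "U \<subseteq> W"
  shows "\<exists>c. \<forall>i. dim U \<le> i \<and> i \<le> dim W \<longrightarrow>
    c i \<in> between U W i \<and> (\<forall>j. i \<le> j \<and> j \<le> dim W \<longrightarrow> c i \<subseteq> c j)"
  using assms
proof (induction "dim W - dim U" arbitrary: U)
  case 0
  then have "U = W" by (intro subspace_eqI) auto
  then show ?case using 0 by (intro exI[of _ "\<lambda>_. U"]) (auto simp: between_iff)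
next
  case (Suc r)
  then obtain x where x: "x \<in> W" "x \<notin> U"
    using diff_self_eq_0 by (metis nat.distinct(1) subsetI subset_antisym)
  let ?U = "span (insert x U)"
  have U': "subspace ?U" "?U \<subseteq> W" "dim ?U = Suc (dim U)" "U \<subseteq> ?U"
    using x Suc.prems span_superset[of "insert x U"]
    by (auto simp: dim_insert_notin span_minimal)
  then have "r = dim W - dim ?U" using Suc.hyps(2) by linarith
  then obtain c where c: "\<forall>i. dim ?U \<le> i \<and> i \<le> dim W \<longrightarrow>
    c i \<in> between ?U W i \<and> (\<forall>j. i \<le> j \<and> j \<le> dim W \<longrightarrow> c i \<subseteq> c j)"
    using Suc.hyps(1)[of ?U] U' Suc.prems by blast
  have c1: "c i \<in> between U W i" "?U \<subseteq> c i" "i \<le> j \<Longrightarrow> j \<le> dim W \<Longrightarrow> c i \<subseteq> c j"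
    if "Suc (dim U) \<le> i" "i \<le> dim W" for i j
    using c that U' subset_trans[OF U'(4)] by (auto simp: between_iff)
  show ?case
  proof (intro exI[of _ "c(dim U := U)"] allI impI conjI)
    fix i assume i: "dim U \<le> i \<and> i \<le> dim W"
    show "(c(dim U := U)) i \<in> between U W i"
      using c1(1)[of i] i Suc.prems by (auto simp: between_iff)
    fix j assume j: "i \<le> j \<and> j \<le> dim W"
    show "(c(dim U := U)) i \<subseteq> (c(dim U := U)) j"
      using c1(3)[of i j] c1(2)[of j] U'(4) i j by (cases "j = dim U"; cases "i = dim U") auto
  qed
qed

lemma exists_between:
  assumes "subspace U" "subspace W" "U \<subseteq> W" "dim U \<le> i" "i \<le> dim W"
  obtains A where "A \<in> between U W i"
  using exists_chain[OF assms(1-3)] assms(4,5) by blast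

text \<open>
  A fat flag is a full flag in which the two subspaces strictly between \<open>U\<close> and \<open>W\<close> are
  replaced by the whole interval \<open>[U, W]\<close>, a projective plane of order \<open>q\<close>.
\<close>

definition fat_flag :: "'b set \<Rightarrow> 'b set \<Rightarrow> nat \<Rightarrow> 'b set set \<Rightarrow> bool" where
  "fat_flag U W d Q \<longleftrightarrow>
    (\<forall>A\<in>Q. subspace A) \<and>
    (\<forall>i\<in>{d + 1, d + 2}. Q \<inter> level i = between U W i) \<and>
    (\<forall>i\<le>n. i \<notin> {d + 1, d + 2} \<longrightarrow> card (Q \<inter> level i) = 1) \<and>
    (\<forall>A\<in>Q. \<forall>B\<in>Q. dim A \<notin> {d + 1, d + 2} \<longrightarrow> A \<subseteq> B \<or> B \<subseteq> A)"

text \<open>A chain from {0} to \<open>U\<close>, the points and lines of [U, W], and a chain from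
  \<open>W\<close> to the whole space are put together. Members of the chains lie below
  \<open>U\<close> or above \<open>W\<close>, hence are comparable to the whole plane.\<close>

lemma exists_fat_flag:
  assumes U: "subspace U" and W: "subspace W" and UW: "U \<subseteq> W" and d: "dim U = d" "dim W = d + 3"
  obtains Q where "fat_flag U W d Q"
proof -
  have U0: "{0} \<subseteq> U" using subspace_0[OF U] by simp
  obtain c1 where "\<forall>i. dim {0} \<le> i \<and> i \<le> dim U \<longrightarrow>
    c1 i \<in> between {0} U i \<and> (\<forall>j. i \<le> j \<and> j \<le> dim U \<longrightarrow> c1 i \<subseteq> c1 j)"
    using exists_chain[OF subspace_single_0 U U0] by metis
  then have c1: "subspace (c1 i)" "dim (c1 i) = i" "c1 i \<subseteq> U" "i \<le> j \<Longrightarrow> j \<le> d \<Longrightarrow> c1 i \<subseteq> c1 j"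
    if "i \<le> d" for i j
    using that by (simp_all add: between_iff d)
  obtain c2 where "\<forall>i. dim W \<le> i \<and> i \<le> dim UNIV \<longrightarrow>
    c2 i \<in> between W UNIV i \<and> (\<forall>j. i \<le> j \<and> j \<le> dim UNIV \<longrightarrow> c2 i \<subseteq> c2 j)"
    using exists_chain[OF W subspace_UNIV subset_UNIV] by metis
  then have c2: "subspace (c2 i)" "dim (c2 i) = i" "W \<subseteq> c2 i" "i \<le> j \<Longrightarrow> j \<le> n \<Longrightarrow> c2 i \<subseteq> c2 j"
    if "d + 3 \<le> i" "i \<le> n" for i j
    using that by (simp_all add: between_iff d card_Basis)
  define M where "M = between U W (d + 1) \<union> between U W (d + 2)"
  have M: "subspace A" "U \<subseteq> A" "A \<subseteq> W" "dim A = d + 1 \<or> dim A = d + 2" if "A \<in> M" for A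
    using that by (auto simp: M_def between_iff)
  define Q where "Q = c1 ` {..d} \<union> M \<union> c2 ` {d + 3..n}"
  have QE: "(\<exists>i\<le>d. A = c1 i) \<or> A \<in> M \<or> (\<exists>i. d + 3 \<le> i \<and> i \<le> n \<and> A = c2 i)" if "A \<in> Q" for A
    using that by (auto simp: Q_def)
  have "subspace A" if "A \<in> Q" for A
    using QE[OF that] c1(1) c2(1) M(1) by auto
  moreover have "Q \<inter> level i = between U W i" if i: "i \<in> {d + 1, d + 2}" for i
  proof
    show "Q \<inter> level i \<subseteq> between U W i"
    proof
      fix A assume A: "A \<in> Q \<inter> level i"
      then have "dim A = i" by (simp add: level_iff)
      then have "A \<in> M" using A QE[of A] c1(2) c2(2) i by fastforce
      then show "A \<in> between U W i" using M[of A] \<open>dim A = i\<close> by (simp add: between_iff)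
    qed
    show "between U W i \<subseteq> Q \<inter> level i"
      using i by (auto simp: Q_def M_def between_def)
  qed
  moreover have "card (Q \<inter> level i) = 1" if i: "i \<le> n" "i \<notin> {d + 1, d + 2}" for i
  proof (cases "i \<le> d")
    case True
    have "Q \<inter> level i = {c1 i}"
    proof (intro subset_antisym subsetI)
      fix A assume A: "A \<in> Q \<inter> level i"
      then have "dim A = i" by (simp add: level_iff)
      then show "A \<in> {c1 i}" using A QE[of A] c1(2) c2(2) M(4)[of A] True by fastforce
    qed (use True c1 in \<open>auto simp: Q_def level_iff\<close>)
    then show ?thesis by simp
  next
    case False
    then have i3: "d + 3 \<le> i" using i by auto
    have "Q \<inter> level i = {c2 i}"
    proof (intro subset_antisym subsetI)
      fix A assume A: "A \<in> Q \<inter> level i"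
      then have "dim A = i" by (simp add: level_iff)
      then show "A \<in> {c2 i}" using A QE[of A] c1(2) c2(2) M(4)[of A] i3 by fastforce
    qed (use i3 i c2 in \<open>auto simp: Q_def level_iff\<close>)
    then show ?thesis by simp
  qed
  moreover have "A \<subseteq> B \<or> B \<subseteq> A" if A: "A \<in> Q" and B: "B \<in> Q" and dA: "dim A \<notin> {d + 1, d + 2}" for A B
  proof -
    consider (1) i where "i \<le> d" "A = c1 i" | (2) i where "d + 3 \<le> i" "i \<le> n" "A = c2 i"
      using QE[OF A] M(4)[of A] dA by auto
    then show ?thesis
    proof cases
      case 1
      consider j where "j \<le> d" "B = c1 j" | "U \<subseteq> B"
        using QE[OF B] M(2)[of B] c2(3) UW by blast
      then show ?thesis
      proof cases
        case (1 j)
        then show ?thesis using c1(4)[of i j] c1(4)[of j i] \<open>i \<le> d\<close> \<open>A = c1 i\<close> by (cases "i \<le> j") auto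
      next
        case 2
        then show ?thesis using c1(3)[of i] 1 by auto
      qed
    next
      case 2
      consider j where "d + 3 \<le> j" "j \<le> n" "B = c2 j" | "B \<subseteq> W"
        using QE[OF B] M(3)[of B] c1(3) UW by blast
      then show ?thesis
      proof cases
        case (1 j)
        then show ?thesis using c2(4)[of i j] c2(4)[of j i] 2 by (cases "i \<le> j") auto
      next
        assume "B \<subseteq> W"
        then show ?thesis using c2(3)[of i] 2 by auto
      qed
    qed
  qed
  ultimately have "fat_flag U W d Q" unfolding fat_flag_def by blast
  then show ?thesis by (rule that)
qed

section \<open>Growth of the level sizes towards the middle\<close>

lemma level_growth_up:
  assumes "i < n" "i + 1 + s \<le> n - i"
  shows "2 ^ s * real (card (level i)) \<le> real (card (level (Suc i)))"
proof -
  have pos: "real q ^ Suc i - 1 > 0"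
    using q_ge_2 power_q_less[of 0 "Suc i"] by (simp flip: of_nat_power of_nat_mult)
  \<comment> \<open>By q^s (q^(i+1) - 1) <= q^(i+1+s) - 1 <= q^(n-i) - 1 the ratio of the levels is
    at least q^s; it is weakened to 2^s, the value for the smallest field.\<close>
  have "2 ^ s * (real q ^ Suc i - 1) \<le> real q ^ s * real q ^ Suc i - 1"
  proof -
    have "(2::real) ^ s \<le> real q ^ s" using q_ge_2 by (intro power_mono) auto
    then have "2 ^ s * (real q ^ Suc i - 1) \<le> real q ^ s * (real q ^ Suc i - 1)"
      using pos by (intro mult_right_mono) auto
    moreover have "real q ^ s \<ge> 1" using q_ge_2 by (intro one_le_power) auto
    ultimately show ?thesis by (simp add: algebra_simps)
  qed
  also have "\<dots> \<le> real q ^ (n - i) - 1"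
    using assms(2) q_ge_2 by (simp add: power_increasing flip: power_add power_Suc)
  finally have le: "2 ^ s * (real q ^ Suc i - 1) \<le> real q ^ (n - i) - 1" .
  have "real (card (level (Suc i)) * (q ^ Suc i - 1)) = real (card (level i) * (q ^ (n - i) - 1))"
    by (simp only: card_level_Suc[OF assms(1)])
  then have eq: "real (card (level (Suc i))) * (real q ^ Suc i - 1) = real (card (level i)) * (real q ^ (n - i) - 1)"
    using q_ge_2 by (simp add: of_nat_diff)
  have "2 ^ s * real (card (level i)) * (real q ^ Suc i - 1) \<le> real (card (level (Suc i))) * (real q ^ Suc i - 1)"
    unfolding eq using mult_left_mono[OF le, of "real (card (level i))"] by (simp add: mult_ac)
  then show ?thesis using pos by (simp only: mult_le_cancel_right_pos)
qed

lemma level_growth_down: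
  assumes "i < n" "n - i + s \<le> i + 1"
  shows "2 ^ s * real (card (level (Suc i))) \<le> real (card (level i))"
proof -
  have pos: "real q ^ (n - i) - 1 > 0"
    using q_ge_2 power_q_less[of 0 "n - i"] assms(1) by (simp flip: of_nat_power of_nat_mult)
  have "2 ^ s * (real q ^ (n - i) - 1) \<le> real q ^ s * real q ^ (n - i) - 1"
  proof -
    have "(2::real) ^ s \<le> real q ^ s" using q_ge_2 by (intro power_mono) auto
    then have "2 ^ s * (real q ^ (n - i) - 1) \<le> real q ^ s * (real q ^ (n - i) - 1)"
      using pos by (intro mult_right_mono) auto
    moreover have "real q ^ s \<ge> 1" using q_ge_2 by (intro one_le_power) auto
    ultimately show ?thesis by (simp add: algebra_simps)
  qed
  also have "\<dots> \<le> real q ^ Suc i - 1"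
    using assms(2) q_ge_2 by (simp add: power_increasing flip: power_add power_Suc)
  finally have le: "2 ^ s * (real q ^ (n - i) - 1) \<le> real q ^ Suc i - 1" .
  have "real (card (level (Suc i)) * (q ^ Suc i - 1)) = real (card (level i) * (q ^ (n - i) - 1))"
    by (simp only: card_level_Suc[OF assms(1)])
  then have eq: "real (card (level (Suc i))) * (real q ^ Suc i - 1) = real (card (level i)) * (real q ^ (n - i) - 1)"
    using q_ge_2 by (simp add: of_nat_diff)
  have "2 ^ s * real (card (level (Suc i))) * (real q ^ (n - i) - 1)
      = real (card (level (Suc i))) * (2 ^ s * (real q ^ (n - i) - 1))" by simp
  also have "\<dots> \<le> real (card (level (Suc i))) * (real q ^ Suc i - 1)"
    using le by (intro mult_left_mono) auto
  finally have "2 ^ s * real (card (level (Suc i))) * (real q ^ (n - i) - 1)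
     \<le> real (card (level i)) * (real q ^ (n - i) - 1)"
    unfolding eq .
  then show ?thesis using pos by (simp only: mult_le_cancel_right_pos)
qed

text \<open>The size of level \<open>i\<close> divided by the number of members that a fat flag has
  there, as \<open>GL_average\<close> demands.\<close>

definition weight :: "nat \<Rightarrow> nat \<Rightarrow> real" where
  "weight d i = (if i \<in> {d + 1, d + 2} then card (level i) / (q\<^sup>2 + q + 1) else card (level i))"

lemma weight_nonneg: "weight d i \<ge> 0"
  by (simp add: weight_def)

lemma sum_levels_below:
  assumes "\<And>i. i < d \<Longrightarrow> (r + 1) * real (card (level i)) \<le> real (card (level (Suc i)))"
  shows "r * (\<Sum>i<d. real (card (level i))) \<le> real (card (level d))"
proof -
  define a where "a i = real (card (level (d - i)))" for i
  have "r * (\<Sum>i<d. a (Suc i)) \<le> a 0 - a d"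
  proof (rule geometric_decay_sum)
    fix i assume "i < d"
    then show "(r + 1) * a (Suc i) \<le> a i"
      using assms[of "d - Suc i"] by (simp add: a_def Suc_diff_Suc)
  qed
  moreover have "(\<Sum>i<d. a (Suc i)) = (\<Sum>i<d. real (card (level i)))"
    unfolding a_def by (rule sum.nat_diff_reindex)
  moreover have "a d \<ge> 0" by (simp add: a_def)
  ultimately show ?thesis by (simp add: a_def)
qed

lemma sum_levels_above:
  assumes "e \<le> n" "\<And>i. e \<le> i \<Longrightarrow> i < n \<Longrightarrow> (r + 1) * real (card (level (Suc i))) \<le> real (card (level i))"
  shows "r * (\<Sum>i\<in>{e<..n}. real (card (level i))) \<le> real (card (level e))"
proof -
  define a where "a i = real (card (level (e + i)))" for i
  have "r * (\<Sum>i<n - e. a (Suc i)) \<le> a 0 - a (n - e)"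
  proof (rule geometric_decay_sum)
    fix i assume "i < n - e"
    then show "(r + 1) * a (Suc i) \<le> a i"
      using assms(2)[of "e + i"] by (simp add: a_def)
  qed
  moreover have "(\<Sum>i<n - e. a (Suc i)) = (\<Sum>i\<in>{e<..n}. real (card (level i)))"
    unfolding a_def
    by (rule sum.reindex_bij_witness[of _ "\<lambda>i. i - Suc e" "\<lambda>i. e + Suc i"]) auto
  moreover have "a (n - e) \<ge> 0" by (simp add: a_def)
  ultimately show ?thesis by (simp add: a_def)
qed

text \<open>For n = 2d + 3 the two dimensions are complementary; for n = 2d + 2 level
  \<open>d + 2\<close> already lies past the middle.\<close>

lemma card_middle_levels:
  assumes "n = 2 * d + 2 \<or> n = 2 * d + 3"
  shows "n = 2 * d + 3 \<Longrightarrow> card (level (d + 2)) = card (level (d + 1))"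
    and "n = 2 * d + 2 \<Longrightarrow> 2 * card (level (d + 2)) \<le> card (level (d + 1))"
proof -
  assume n: "n = 2 * d + 3"
  have "q ^ (d + 2) - 1 \<noteq> 0" using power_q_less[of 0 "d + 2"] by simp
  then show "card (level (d + 2)) = card (level (d + 1))"
    using card_level_Suc[of "d + 1"] n by simp
next
  assume n: "n = 2 * d + 2"
  show "2 * card (level (d + 2)) \<le> card (level (d + 1))"
  proof (cases "d + 1 < n")
    case True
    then have "2 * real (card (level (d + 2))) \<le> real (card (level (d + 1)))"
      using level_growth_down[of "d + 1" 1] n by simp
    then show ?thesis by simp
  next
    case False
    then show ?thesis using n by simp
  qed
qed

text \<open>The sum bounds the weight that a chain can collect on a fat flag. With N the size of
  level \<open>d + 1\<close>, the estimates give at most (1/12 + 1/4 + 2/7 + 1/3) N = 20/21 N for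
  odd \<open>n\<close> and (1/14 + 1/2 + 3/14 + 1/14) N = 6/7 N for even \<open>n\<close>. The 7 in
  2/7 is q^2 + q + 1 for q = 2.\<close>

lemma sum_weights_less:
  assumes n: "n = 2 * d + 2 \<and> d \<ge> 1 \<or> n = 2 * d + 3"
  shows "(\<Sum>i\<le>n. weight d i) < card (level (d + 1))"
proof -
  let ?N = "\<lambda>i. real (card (level i))"
  define A B where "A = (\<Sum>i<d. ?N i)" and "B = (\<Sum>i\<in>{d + 2<..n}. ?N i)"
  have "{..n} = {..<d} \<union> {d, d + 1, d + 2} \<union> {d + 2<..n}" using n by auto
  then have "(\<Sum>i\<le>n. weight d i) = (\<Sum>i\<in>{..<d} \<union> {d, d + 1, d + 2}. weight d i) + (\<Sum>i\<in>{d + 2<..n}. weight d i)"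
    by (simp only:) (rule sum.union_disjoint; auto)
  also have "(\<Sum>i\<in>{..<d} \<union> {d, d + 1, d + 2}. weight d i) = (\<Sum>i<d. weight d i) + (\<Sum>i\<in>{d, d + 1, d + 2}. weight d i)"
    by (rule sum.union_disjoint) auto
  also have "(\<Sum>i<d. weight d i) = A" by (simp add: A_def weight_def)
  also have "(\<Sum>i\<in>{d + 2<..n}. weight d i) = B"
    unfolding B_def by (rule sum.cong) (auto simp: weight_def)
  also have "(\<Sum>i\<in>{d, d + 1, d + 2}. weight d i) = ?N d + (?N (d + 1) + ?N (d + 2)) / (q\<^sup>2 + q + 1)"
    by (simp add: weight_def add_divide_distrib)
  also have "(?N (d + 1) + ?N (d + 2)) / (q\<^sup>2 + q + 1) \<le> (?N (d + 1) + ?N (d + 2)) / 7"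
  proof (rule divide_left_mono)
    have "2 ^ 2 \<le> q\<^sup>2" using q_ge_2 by (intro power_mono) auto
    then have "7 \<le> q\<^sup>2 + q + 1" using q_ge_2 by simp
    then show "7 \<le> real (q\<^sup>2 + q + 1)" by linarith
    then show "0 < real (q\<^sup>2 + q + 1) * 7" by simp
  qed simp
  finally have S: "(\<Sum>i\<le>n. weight d i) \<le> A + (?N d + (?N (d + 1) + ?N (d + 2)) / 7) + B" by simp
  have pos: "?N (d + 1) > 0" using card_level_pos[of "d + 1"] n by auto
  show ?thesis
  proof (cases "n = 2 * d + 3")
    case True
    \<comment> \<open>The ratio of consecutive levels is at least 4 here, so \<open>r = 3\<close>;
      in the even case below it is at least 8 away from the middle, so \<open>r = 7\<close>.\<close>
    have "3 * A \<le> ?N d" unfolding A_def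
      using level_growth_up[of _ 2] True by (intro sum_levels_below) auto
    moreover have "3 * B \<le> ?N (d + 2)" unfolding B_def
      using level_growth_down[of _ 2] True by (intro sum_levels_above) auto
    moreover have "4 * ?N d \<le> ?N (d + 1)" using level_growth_up[of d 2] True by simp
    moreover have "?N (d + 2) = ?N (d + 1)" using card_middle_levels(1) True by simp
    ultimately have "3 * A \<le> ?N d \<and> 3 * B \<le> ?N (d + 2) \<and> 4 * ?N d \<le> ?N (d + 1) \<and> ?N (d + 2) = ?N (d + 1)" by blast
    then have "A + (?N d + (?N (d + 1) + ?N (d + 2)) / 7) + B < ?N (d + 1)" using pos by argo
    then show ?thesis using S by linarith
  next
    case False
    then have n2: "n = 2 * d + 2" "d \<ge> 1" using n by auto
    have "7 * A \<le> ?N d" unfolding A_def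
      using level_growth_up[of _ 3] n2 by (intro sum_levels_below) auto
    moreover have "7 * B \<le> ?N (d + 2)" unfolding B_def
      using level_growth_down[of _ 3] n2 by (intro sum_levels_above) auto
    moreover have "2 * ?N d \<le> ?N (d + 1)" using level_growth_up[of d 1] n2 by simp
    moreover have "2 * ?N (d + 2) \<le> ?N (d + 1)"
      using card_middle_levels(2)[of d] n2 of_nat_mono[of "2 * card (level (d + 2))" "card (level (d + 1))"] by simp
    ultimately have "7 * A \<le> ?N d \<and> 7 * B \<le> ?N (d + 2) \<and> 2 * ?N d \<le> ?N (d + 1) \<and> 2 * ?N (d + 2) \<le> ?N (d + 1)" by blast
    then have "A + (?N d + (?N (d + 1) + ?N (d + 2)) / 7) + B < ?N (d + 1)" using pos by argo
    then show ?thesis using S by linarith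
  qed
qed


subsection \<open>Families restricted to a fat flag\<close>

lemma sparse_pair_between:
  assumes F: "free F" and U: "subspace U" and W: "subspace W" and UW: "U \<subseteq> W" and d: "dim W = dim U + 3"
  shows "sparse_pair (between U W (dim U + 1)) (between U W (dim U + 2)) (\<subseteq>) q
    (F \<inter> between U W (dim U + 1)) (F \<inter> between U W (dim U + 2))"
proof -
  interpret p: projective_plane "between U W (dim U + 1)" "between U W (dim U + 2)" "(\<subseteq>)" q
    using projective_plane_between[OF U W UW d] by simp
  have eq: "A = A'" if "A \<in> level i" "A' \<in> level i" "A \<subseteq> A' \<or> A' \<subseteq> A" for A A' i
    using that level_antichain[of A i A'] level_antichain[of A' i A] by auto
  show ?thesis
  proof
    fix B assume B: "B \<in> F \<inter> between U W (dim U + 2)"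
    have "A = A'" if "A \<in> F \<inter> between U W (dim U + 1)" "A' \<in> F \<inter> between U W (dim U + 1)" "A \<subseteq> B" "A' \<subseteq> B" for A A'
      using that B free_below[OF F, of B A A'] eq[of A "dim U + 1" A'] by (simp add: between_def)
    then show "card {A \<in> F \<inter> between U W (dim U + 1). A \<subseteq> B} \<le> 1"
      by (simp add: card_le_Suc0_iff_eq)
  next
    fix B assume B: "B \<in> F \<inter> between U W (dim U + 1)"
    have "A = A'" if "A \<in> F \<inter> between U W (dim U + 2)" "A' \<in> F \<inter> between U W (dim U + 2)" "B \<subseteq> A" "B \<subseteq> A'" for A A'
      using that B free_above[OF F, of B A A'] eq[of A "dim U + 2" A'] by (simp add: between_def)
    then show "card {A \<in> F \<inter> between U W (dim U + 2). B \<subseteq> A} \<le> 1"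
      by (simp add: card_le_Suc0_iff_eq)
  qed auto
qed

lemma free_card_le_rank3:
  assumes F: "free F" and U: "subspace U" and W: "subspace W" and UW: "U \<subseteq> W" and d: "dim W = dim U + 3"
  shows "card (F \<inter> between U W (dim U + 1)) + card (F \<inter> between U W (dim U + 2)) \<le> q\<^sup>2 + q + 1"
  using sparse_pair.card_le[OF sparse_pair_between[OF assms]] .

definition flag_weight :: "nat \<Rightarrow> 'b set set \<Rightarrow> 'b set set \<Rightarrow> real" where
  "flag_weight d Q F = (\<Sum>A\<in>Q \<inter> F. weight d (dim A))"

text \<open>\<open>C\<close> is comparable to the whole fat flag, so \<open>free_comparable\<close>
  makes \<open>Q \<inter> F\<close> a chain, with at most one member in each level.\<close>

lemma flag_weight_outside:
  assumes n: "n = 2 * d + 2 \<and> d \<ge> 1 \<or> n = 2 * d + 3" and F: "free F" and Q: "fat_flag U W d Q"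
    and C: "C \<in> Q \<inter> F" "dim C \<notin> {d + 1, d + 2}"
  shows "flag_weight d Q F < card (level (d + 1))"
proof -
  have sub: "subspace A" if "A \<in> Q \<inter> F" for A
    using Q that by (auto simp: fat_flag_def)
  have cmp: "C \<subseteq> A \<or> A \<subseteq> C" if "A \<in> Q \<inter> F" for A
    using Q C that unfolding fat_flag_def by blast
  have chain: "A \<subseteq> B \<or> B \<subseteq> A" if "A \<in> Q \<inter> F" "B \<in> Q \<inter> F" for A B
    using free_comparable[OF F, of C A B] C(1) cmp[of A] cmp[of B] that by blast
  have "inj_on dim (Q \<inter> F)"
  proof (rule inj_onI)
    fix A B assume *: "A \<in> Q \<inter> F" "B \<in> Q \<inter> F" "dim A = dim B"
    then show "A = B"
      using chain[of A B] subspace_eqI[of A B] subspace_eqI[of B A] sub[of A] sub[of B] by auto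
  qed
  then have "flag_weight d Q F = (\<Sum>i\<in>dim ` (Q \<inter> F). weight d i)"
    unfolding flag_weight_def by (subst sum.reindex) auto
  also have "\<dots> \<le> (\<Sum>i\<le>n. weight d i)"
    using dim_le_n weight_nonneg by (intro sum_mono2) auto
  also have "\<dots> < card (level (d + 1))" by (rule sum_weights_less[OF n])
  finally show ?thesis .
qed

lemma flag_weight_inside:
  assumes F: "free F" and Q: "fat_flag U W d Q"
    and inside: "\<And>A. A \<in> Q \<inter> F \<Longrightarrow> dim A \<in> {d + 1, d + 2}"
  shows "flag_weight d Q F =
    (card (F \<inter> between U W (d + 1)) * card (level (d + 1)) + card (F \<inter> between U W (d + 2)) * card (level (d + 2)))
      / (q\<^sup>2 + q + 1)"
proof -
  have eq: "Q \<inter> F \<inter> level i = F \<inter> between U W i" if "i \<in> {d + 1, d + 2}" for i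
    using Q that unfolding fat_flag_def by blast
  have "Q \<inter> F = (Q \<inter> F \<inter> level (d + 1)) \<union> (Q \<inter> F \<inter> level (d + 2))"
  proof (intro subset_antisym subsetI)
    fix A assume "A \<in> Q \<inter> F"
    then show "A \<in> (Q \<inter> F \<inter> level (d + 1)) \<union> (Q \<inter> F \<inter> level (d + 2))"
      using inside[of A] free_subspace[OF F, of A] by (auto simp: level_iff)
  qed auto
  then have un: "Q \<inter> F = (F \<inter> between U W (d + 1)) \<union> (F \<inter> between U W (d + 2))"
    using eq by simp
  have "flag_weight d Q F = (\<Sum>A\<in>F \<inter> between U W (d + 1). weight d (dim A)) + (\<Sum>A\<in>F \<inter> between U W (d + 2). weight d (dim A))"
    unfolding flag_weight_def un by (rule sum.union_disjoint) (auto simp: between_iff)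
  also have "(\<Sum>A\<in>F \<inter> between U W (d + 1). weight d (dim A)) = (\<Sum>A\<in>F \<inter> between U W (d + 1). weight d (d + 1))"
    by (rule sum.cong) (auto simp: between_iff)
  also have "(\<Sum>A\<in>F \<inter> between U W (d + 2). weight d (dim A)) = (\<Sum>A\<in>F \<inter> between U W (d + 2). weight d (d + 2))"
    by (rule sum.cong) (auto simp: between_iff)
  finally show ?thesis by (simp add: weight_def add_divide_distrib)
qed

text \<open>The bound is strict when \<open>F\<close> meets the flag outside the plane. Inside,
  equality requires that \<open>s + t\<close> is as large as possible and that the lines weigh as
  much as points would; for even \<open>n\<close> level \<open>d + 2\<close> is strictly smaller,
  which forces \<open>t = 0\<close>.\<close>

lemma flag_weight_bound:
  assumes n: "n = 2 * d + 2 \<and> d \<ge> 1 \<or> n = 2 * d + 3" and F: "free F"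
    and U: "subspace U" and W: "subspace W" and UW: "U \<subseteq> W" and d: "dim U = d" "dim W = d + 3"
    and Q: "fat_flag U W d Q"
  shows "flag_weight d Q F \<le> card (level (d + 1))"
    and "flag_weight d Q F = card (level (d + 1)) \<Longrightarrow>
      (\<forall>A\<in>Q \<inter> F. dim A \<in> {d + 1, d + 2}) \<and>
      card (F \<inter> between U W (d + 1)) + card (F \<inter> between U W (d + 2)) = q\<^sup>2 + q + 1 \<and>
      (n = 2 * d + 2 \<longrightarrow> F \<inter> between U W (d + 2) = {})"
proof -
  define s t where "s = card (F \<inter> between U W (d + 1))" and "t = card (F \<inter> between U W (d + 2))"
  define M M' where "M = card (level (d + 1))" and "M' = card (level (d + 2))"
  have qpos: "0 < real (q\<^sup>2 + q + 1)" by linarith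
  have st: "s + t \<le> q\<^sup>2 + q + 1"
    using free_card_le_rank3[OF F U W UW] d by (simp add: s_def t_def)
  have M: "M > 0" using card_level_pos[of "d + 1"] n by (auto simp: M_def)
  have M': "M' \<le> M" "n = 2 * d + 2 \<Longrightarrow> M' < M"
    using card_middle_levels[of d] n M unfolding M_def M'_def by auto
  have le: "s * M + t * M' \<le> (s + t) * M" "(s + t) * M \<le> (q\<^sup>2 + q + 1) * M"
    using M'(1) mult_le_mono1[OF st, of M] by (simp_all add: add_mult_distrib)
  have inside: "flag_weight d Q F = real (s * M + t * M') / real (q\<^sup>2 + q + 1)"
    if "\<And>A. A \<in> Q \<inter> F \<Longrightarrow> dim A \<in> {d + 1, d + 2}"
    using flag_weight_inside[OF F Q that] by (simp add: s_def t_def M_def M'_def)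
  show "flag_weight d Q F \<le> card (level (d + 1))"
  proof (cases "\<forall>A\<in>Q \<inter> F. dim A \<in> {d + 1, d + 2}")
    case True
    have "real (s * M + t * M') \<le> real ((q\<^sup>2 + q + 1) * M)"
      using le by (simp only: of_nat_le_iff)
    then have "real (s * M + t * M') / real (q\<^sup>2 + q + 1) \<le> real M"
      by (simp only: pos_divide_le_eq[OF qpos] of_nat_mult mult.commute)
    then show ?thesis using inside True by (simp add: M_def)
  next
    case False
    then show ?thesis using flag_weight_outside[OF n F Q] by fastforce
  qed
  assume eq: "flag_weight d Q F = card (level (d + 1))"
  then have in_mid: "\<forall>A\<in>Q \<inter> F. dim A \<in> {d + 1, d + 2}"
    using flag_weight_outside[OF n F Q] by fastforce
  then have "real (s * M + t * M') / real (q\<^sup>2 + q + 1) = real M"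
    using inside eq by (simp add: M_def)
  then have "real (s * M + t * M') = real ((q\<^sup>2 + q + 1) * M)"
    using qpos by (simp only: of_nat_mult) (simp add: divide_eq_eq mult.commute)
  then have "s * M + t * M' = (q\<^sup>2 + q + 1) * M" by (simp only: of_nat_eq_iff)
  then have e: "(s + t) * M = (q\<^sup>2 + q + 1) * M" "s * M + t * M' = (s + t) * M"
    using le by linarith+
  then have "s + t = q\<^sup>2 + q + 1" using M by (metis mult_cancel2 less_irrefl)
  moreover have "t = 0" if "n = 2 * d + 2"
    using e(2) M'(2)[OF that] by (simp add: add_mult_distrib)
  ultimately show "(\<forall>A\<in>Q \<inter> F. dim A \<in> {d + 1, d + 2}) \<and>
      card (F \<inter> between U W (d + 1)) + card (F \<inter> between U W (d + 2)) = q\<^sup>2 + q + 1 \<and>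
      (n = 2 * d + 2 \<longrightarrow> F \<inter> between U W (d + 2) = {})"
    using in_mid by (simp add: s_def t_def)
qed

lemma weight_fat_flag:
  assumes U: "subspace U" and W: "subspace W" and UW: "U \<subseteq> W" and d: "dim U = d" "dim W = d + 3"
    and Q: "fat_flag U W d Q" and i: "i \<le> n"
  shows "weight d i * card (Q \<inter> level i) = card (level i)"
proof (cases "i \<in> {d + 1, d + 2}")
  case True
  then have "Q \<inter> level i = between U W i" using Q unfolding fat_flag_def by blast
  moreover have "card (between U W i) = q\<^sup>2 + q + 1"
    using True card_points_rank3[OF U W UW] card_lines_rank3[OF U W UW] d by auto
  moreover have "real (q\<^sup>2 + q + 1) \<noteq> 0" by linarith
  ultimately show ?thesis using True by (simp add: weight_def)
next
  case False
  then have "card (Q \<inter> level i) = 1" using Q i unfolding fat_flag_def by blast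
  then show ?thesis using False by (simp add: weight_def)
qed

lemma GL_average_flag_weight:
  assumes F: "free F"
    and U: "subspace U" and W: "subspace W" and UW: "U \<subseteq> W" and d: "dim U = d" "dim W = d + 3"
    and Q: "fat_flag U W d Q"
  shows "(\<Sum>g\<in>GL. flag_weight d Q {A. subspace A \<and> g ` A \<in> F}) = card GL * card F"
proof -
  have "Q \<inter> {A. subspace A \<and> g ` A \<in> F} = {A \<in> Q. g ` A \<in> F}" for g
    using Q by (auto simp: fat_flag_def)
  then have "(\<Sum>g\<in>GL. flag_weight d Q {A. subspace A \<and> g ` A \<in> F}) =
      (\<Sum>g\<in>GL. \<Sum>A\<in>{A \<in> Q. g ` A \<in> F}. weight d (dim A))"
    by (simp add: flag_weight_def)
  also have "\<dots> = card GL * card F"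
    using Q free_subspace[OF F] weight_fat_flag[OF U W UW d Q]
    by (intro GL_average) (auto simp: fat_flag_def)
  finally show ?thesis .
qed

lemma middle_interval_exists:
  assumes "d + 3 \<le> n"
  obtains U W where "subspace U" "subspace W" "U \<subseteq> W" "dim U = d" "dim W = d + 3"
proof -
  obtain W where W: "W \<in> level (d + 3)" using level_nonempty[OF assms] by blast
  then have "{0} \<subseteq> W" using subspace_0 by (auto simp: level_iff)
  then obtain U where "U \<in> between {0} W d"
    using exists_between[of "{0}" W d] W by (auto simp: level_iff)
  then show ?thesis using that W by (auto simp: level_iff between_iff)
qed

section \<open>The upper bound and the case of equality\<close>

lemma free_card_le:
  assumes n: "n = 2 * d + 2 \<and> d \<ge> 1 \<or> n = 2 * d + 3" and F: "free F"
  shows "card F \<le> card (level (d + 1))"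
proof -
  have "d + 3 \<le> n" using n by linarith
  then obtain U W where UW: "subspace U" "subspace W" "U \<subseteq> W" "dim U = d" "dim W = d + 3"
    by (rule middle_interval_exists)
  obtain Q where Q: "fat_flag U W d Q" using exists_fat_flag[OF UW] .
  have "real (card GL) * real (card F) = (\<Sum>g\<in>GL. flag_weight d Q {A. subspace A \<and> g ` A \<in> F})"
    using GL_average_flag_weight[OF F UW Q] by simp
  also have "\<dots> \<le> (\<Sum>g\<in>GL. real (card (level (d + 1))))"
    using flag_weight_bound(1)[OF n free_vimage[OF _ F] UW Q] by (intro sum_mono)
  finally have "real (card GL) * real (card F) \<le> real (card GL) * real (card (level (d + 1)))" by simp
  then show ?thesis using card_GL_pos by simp
qed

text \<open>The average over \<open>GL\<close> attains the bound that holds for every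
  \<open>g\<close>, so no \<open>g\<close> can fall below it.\<close>

lemma flag_weight_extremal:
  assumes n: "n = 2 * d + 2 \<and> d \<ge> 1 \<or> n = 2 * d + 3" and F: "free F" and max: "card F = card (level (d + 1))"
    and UW: "subspace U" "subspace W" "U \<subseteq> W" "dim U = d" "dim W = d + 3"
    and Q: "fat_flag U W d Q" and g: "g \<in> GL"
  shows "flag_weight d Q {A. subspace A \<and> g ` A \<in> F} = card (level (d + 1))"
proof -
  let ?f = "\<lambda>g. flag_weight d Q {A. subspace A \<and> g ` A \<in> F}"
  have "(\<Sum>g\<in>GL. ?f g) = (\<Sum>g\<in>GL. real (card (level (d + 1))))"
    using GL_average_flag_weight[OF F UW Q] max by simp
  then show ?thesis
    using flag_weight_bound(1)[OF n free_vimage[OF _ F] UW Q] finite_GL g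
    by (intro sum_mono_inv[of ?f GL "\<lambda>_. real (card (level (d + 1)))" g]) auto
qed

text \<open>A member \<open>C\<close> outside the two levels would be the image of the member of
  \<open>Q\<close> of the same dimension, and this image of the flag would miss the bound. The
  statement on intervals is the case \<open>g = id\<close>, for a fat flag built around the given
  interval.\<close>

lemma extremal_middle:
  assumes n: "n = 2 * d + 2 \<and> d \<ge> 1 \<or> n = 2 * d + 3" and F: "free F" and max: "card F = card (level (d + 1))"
  shows "F \<subseteq> level (d + 1) \<union> level (d + 2)"
    and "subspace U \<Longrightarrow> subspace W \<Longrightarrow> U \<subseteq> W \<Longrightarrow> dim U = d \<Longrightarrow> dim W = d + 3 \<Longrightarrow>
      card (F \<inter> between U W (d + 1)) + card (F \<inter> between U W (d + 2)) = q\<^sup>2 + q + 1 \<and>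
      (n = 2 * d + 2 \<longrightarrow> F \<inter> between U W (d + 2) = {})"
proof -
  show "F \<subseteq> level (d + 1) \<union> level (d + 2)"
  proof
    fix C assume C: "C \<in> F"
    have "d + 3 \<le> n" using n by linarith
    then obtain U W where UW: "subspace U" "subspace W" "U \<subseteq> W" "dim U = d" "dim W = d + 3"
      by (rule middle_interval_exists)
    obtain Q where Q: "fat_flag U W d Q" using exists_fat_flag[OF UW] .
    have Cl: "C \<in> level (dim C)" using free_subspace[OF F C] by (simp add: level_iff)
    have "dim C \<in> {d + 1, d + 2}"
    proof (rule ccontr)
      assume not_mid: "dim C \<notin> {d + 1, d + 2}"
      then have "card (Q \<inter> level (dim C)) = 1"
        using Q dim_le_n[of C] unfolding fat_flag_def by blast
      then obtain B where B: "B \<in> Q" "B \<in> level (dim C)"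
        by (metis IntE card_1_singletonE singletonI)
      obtain g where g: "g \<in> GL" "g ` B = C" using GL_transitive[OF B(2) Cl] .
      have "B \<in> Q \<inter> {A. subspace A \<and> g ` A \<in> F}" using B g C by (simp add: level_iff)
      moreover have "dim B = dim C" using B by (simp add: level_iff)
      ultimately show False
        using flag_weight_bound(2)[OF n free_vimage[OF g(1) F] UW Q flag_weight_extremal[OF n F max UW Q g(1)]]
          not_mid by metis
    qed
    then show "C \<in> level (d + 1) \<union> level (d + 2)" using Cl by auto
  qed
  assume UW: "subspace U" "subspace W" "U \<subseteq> W" "dim U = d" "dim W = d + 3"
  obtain Q where Q: "fat_flag U W d Q" using exists_fat_flag[OF UW] .
  have "{A. subspace A \<and> id ` A \<in> F} = F" using free_subspace[OF F] by auto
  then show "card (F \<inter> between U W (d + 1)) + card (F \<inter> between U W (d + 2)) = q\<^sup>2 + q + 1 \<and>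
      (n = 2 * d + 2 \<longrightarrow> F \<inter> between U W (d + 2) = {})"
    using flag_weight_bound(2)[OF n F UW Q] flag_weight_extremal[OF n F max UW Q id_in_GL] by simp
qed

text \<open>Every subspace of dimension \<open>d + 2\<close> lies in some interval [U, W], and no
  such interval has a line in \<open>F\<close>.\<close>

lemma extremal_even:
  assumes n: "n = 2 * d + 2" "d \<ge> 1" and F: "free F" and max: "card F = card (level (d + 1))"
  shows "F = level (d + 1)"
proof (rule card_subset_eq)
  show "F \<subseteq> level (d + 1)"
  proof
    fix B assume B: "B \<in> F"
    show "B \<in> level (d + 1)"
    proof (rule ccontr)
      assume "B \<notin> level (d + 1)"
      then have Bl: "subspace B" "dim B = d + 2"
        using extremal_middle(1)[of d F] n F max B by (auto simp: level_iff)
      obtain U where U: "U \<in> between {0} B d"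
        using exists_between[of "{0}" B d] Bl subspace_0 by auto
      obtain W where W: "W \<in> between B UNIV (d + 3)"
        using exists_between[of B UNIV "d + 3"] Bl n by (auto simp: card_Basis)
      have "U \<subseteq> W" "B \<in> F \<inter> between U W (d + 2)" using U W Bl B by (auto simp: between_iff)
      then show False
        using extremal_middle(2)[of d F U W] n F max U W by (auto simp: between_iff)
    qed
  qed
qed (simp_all add: max)

end

section \<open>Intervals of rank four\<close>

text \<open>Here \<open>s\<close> and \<open>t\<close> count points and lines of the family and
  \<open>e\<close> their incidences; let r be the number of missing points. If s, r > 0, then e <= s
  gives r <= 2q and e <= t gives (q + 1) s <= 2q (q^2 + q + 1). As s + r = q^3 + q^2 + q + 1, this
  yields q^4 + 1 <= 2q^2 + 2q, which fails for q >= 2.\<close>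

lemma rank4_arithmetic:
  fixes q s t e :: int
  assumes q: "q \<ge> 2" and s: "0 \<le> s" "s \<le> q ^ 3 + q ^ 2 + q + 1" and e: "e \<le> s" "e \<le> t"
    and t: "(q + 1) * t = (q ^ 2 + q + 1) * (q ^ 3 + q ^ 2 + q + 1 - s)"
    and incidences: "s * (q ^ 3 + q ^ 2 + q + 1 - s) \<le> 2 * q * e"
  shows "s = 0 \<or> s = q ^ 3 + q ^ 2 + q + 1"
proof (rule ccontr)
  assume neg: "\<not> (s = 0 \<or> s = q ^ 3 + q ^ 2 + q + 1)"
  define r where "r = q ^ 3 + q ^ 2 + q + 1 - s"
  have pos: "s > 0" "r > 0" using neg s by (auto simp: r_def)
  have "s * r \<le> 2 * q * e" using incidences by (simp add: r_def)
  also have "\<dots> \<le> 2 * q * s" using e q by (intro mult_left_mono) auto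
  finally have "s * r \<le> s * (2 * q)" by (simp add: mult_ac)
  then have r: "r \<le> 2 * q" using pos by simp
  have "s * r \<le> 2 * q * e" using incidences by (simp add: r_def)
  also have "\<dots> \<le> 2 * q * t" using e q by (intro mult_left_mono) auto
  finally have "(q + 1) * (s * r) \<le> (q + 1) * (2 * q * t)" using q by (intro mult_left_mono) auto
  also have "\<dots> = 2 * q * ((q + 1) * t)" by simp
  also have "\<dots> = 2 * q * (q ^ 2 + q + 1) * r" unfolding t by (simp add: r_def)
  finally have "((q + 1) * s) * r \<le> (2 * q * (q ^ 2 + q + 1)) * r" by (simp add: mult_ac)
  then have "(q + 1) * s \<le> 2 * q * (q ^ 2 + q + 1)" using pos by simp
  moreover have "(q + 1) * (q ^ 3 + q ^ 2 + q + 1 - 2 * q) \<le> (q + 1) * s"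
    using r q by (intro mult_left_mono) (auto simp: r_def)
  ultimately have "(q + 1) * (q ^ 3 + q ^ 2 + q + 1 - 2 * q) \<le> 2 * q * (q ^ 2 + q + 1)" by linarith
  then have "q ^ 2 * q ^ 2 + 1 \<le> 2 * q ^ 2 + 2 * q"
    by (simp add: algebra_simps power2_eq_square power3_eq_cube)
  moreover have four: "4 \<le> q ^ 2" using power_mono[of 2 q 2] q by simp
  moreover have "4 * q ^ 2 \<le> q ^ 2 * q ^ 2" using four by (intro mult_right_mono) auto
  moreover have "2 * q \<le> q ^ 2" using q by (simp add: power2_eq_square)
  ultimately show False by linarith
qed

context finite_geometry
begin

text \<open>Adding the product bounds of the planes [U, C] gives (q + 1) |S| (p - |S|) <= 2q (q + 1)
  e, with p the number of all points. The left side comes from the two moments of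
  \<open>s C\<close>, because \<open>s C + t C\<close> is constant; on the right each line lies in q
  + 1 planes. A single plane may be mixed for q = 2, but \<open>e\<close> is bounded by
  \<open>card S\<close> and by \<open>card T\<close> in the whole interval.\<close>

lemma rank4_homogeneous:
  assumes F: "free F" and U: "subspace U" and W: "subspace W" and UW: "U \<subseteq> W" and d: "dim W = dim U + 4"
    and tight: "\<And>C. C \<in> between U W (dim U + 3) \<Longrightarrow>
      card (F \<inter> between U C (dim U + 1)) + card (F \<inter> between U C (dim U + 2)) = q\<^sup>2 + q + 1"
  shows "F \<inter> between U W (dim U + 1) = {} \<or> between U W (dim U + 1) \<subseteq> F"
proof -
  define P S T H where "P = between U W (dim U + 1)" and "S = F \<inter> P"
    and "T = F \<inter> between U W (dim U + 2)" and "H = between U W (dim U + 3)"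
  let ?m = "q\<^sup>2 + q + 1" and ?p = "q ^ 3 + q\<^sup>2 + q + 1"
  define s t where "s C = card {A \<in> S. A \<subseteq> C}" and "t C = card {B \<in> T. B \<subseteq> C}" for C
  define e where "e = (\<Sum>B\<in>T. card {A \<in> S. A \<subseteq> B})"
  have HD: "subspace C" "U \<subseteq> C" "C \<subseteq> W" "dim C = dim U + 3" if "C \<in> H" for C
    using that by (auto simp: H_def between_iff)
  have restr: "{A \<in> between U W i. A \<subseteq> C} = between U C i" if "C \<in> H" for C i
    using HD(3)[OF that] by (intro set_eqI, simp add: between_iff) (metis subset_trans)
  have SC: "{A \<in> S. A \<subseteq> C} = F \<inter> between U C (dim U + 1)" if "C \<in> H" for C
    using restr[OF that, of "dim U + 1"] by (auto simp: S_def P_def)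
  have TC: "{B \<in> T. B \<subseteq> C} = F \<inter> between U C (dim U + 2)" if "C \<in> H" for C
    using restr[OF that, of "dim U + 2"] by (auto simp: T_def)
  have through1: "card {C \<in> H. A \<subseteq> C} = ?m" if A: "A \<in> P" for A
  proof -
    have "{C \<in> H. A \<subseteq> C} = between A W (dim A + 2)"
      using A by (intro set_eqI) (auto simp: between_iff H_def P_def del: subsetI intro: subset_trans[of U A])
    then show ?thesis using card_lines_rank3[of A W] A W d by (simp add: P_def between_iff)
  qed
  have through_line: "card {C \<in> H. B \<subseteq> C} = q + 1" if B: "B \<in> between U W (dim U + 2)" for B
  proof -
    have "{C \<in> H. B \<subseteq> C} = between B W (Suc (dim B))"
      using B by (intro set_eqI) (auto simp: between_iff H_def del: subsetI intro: subset_trans[of U B])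
    then show ?thesis using card_points_rank2[of B W] B W d by (simp add: between_iff)
  qed
  have through2: "card {C \<in> H. A \<subseteq> C \<and> A' \<subseteq> C} = q + 1" if A: "A \<in> P" "A' \<in> P" "A \<noteq> A'" for A A'
  proof -
    have sub: "subspace A" "subspace A'" "U \<subseteq> A" "A \<subseteq> W" "A' \<subseteq> W" using A by (auto simp: P_def between_iff)
    have "dim (A + A') = dim U + 2" using inter_points(2)[OF U, of A W A'] A by (simp add: P_def)
    then have "A + A' \<in> between U W (dim U + 2)"
      using sub plus_upper[of A A'] plus_least[OF sub(1,2) W] by (auto simp: between_iff subspace_plus)
    moreover have "{C \<in> H. A \<subseteq> C \<and> A' \<subseteq> C} = {C \<in> H. A + A' \<subseteq> C}"
      using plus_upper[OF sub(1,2)] plus_least[OF sub(1,2)] HD(1) by blast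
    ultimately show ?thesis using through_line by simp
  qed
  have sum1: "(\<Sum>C\<in>H. s C) = card S * ?m"
    unfolding s_def using through1 by (intro sum_card_incidences) (auto simp: S_def)
  have sum2: "(\<Sum>C\<in>H. (s C)\<^sup>2) = card S * ?m + card S * (card S - 1) * (q + 1)"
    unfolding s_def using through1 through2 by (intro sum_card_incidences_square) (auto simp: S_def)
  have sumT: "(\<Sum>C\<in>H. t C) = card T * (q + 1)"
    unfolding t_def using through_line by (intro sum_card_incidences) (auto simp: T_def)
  have cardP: "card P = ?p"
    using card_points_rank4[OF U W UW d] by (simp add: P_def)
  have "(\<Sum>C\<in>H. card {A \<in> P. A \<subseteq> C}) = card P * ?m"
    using through1 by (intro sum_card_incidences) auto
  moreover have "card {A \<in> P. A \<subseteq> C} = ?m" if "C \<in> H" for C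
    using restr[OF that, of "dim U + 1"] card_points_rank3[OF U HD(1,2,4)[OF that]] by (simp add: P_def)
  ultimately have "card H * ?m = ?p * ?m" using cardP by simp
  then have cardH: "card H = ?p" by (metis Suc_eq_plus1 mult_cancel2 nat.distinct(1))
  have st: "s C + t C = ?m" if "C \<in> H" for C
    using tight[of C] that by (simp add: s_def t_def SC TC H_def)
  have "(\<Sum>C\<in>H. s C + t C) = ?p * ?m" using st cardH by simp
  then have T_eq: "card S * ?m + card T * (q + 1) = ?p * ?m"
    by (simp only: sum.distrib sum1 sumT)
  have swap: "(\<Sum>C\<in>H. \<Sum>B\<in>{B \<in> T. B \<subseteq> C}. card {A \<in> S. A \<subseteq> B}) = (q + 1) * e"
  proof -
    have "(\<Sum>C\<in>H. \<Sum>B\<in>{B \<in> T. B \<subseteq> C}. card {A \<in> S. A \<subseteq> B}) =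
      (\<Sum>B\<in>T. \<Sum>C\<in>{C \<in> H. B \<subseteq> C}. card {A \<in> S. A \<subseteq> B})"
      by (rule sum.swap_restrict) auto
    also have "\<dots> = (\<Sum>B\<in>T. (q + 1) * card {A \<in> S. A \<subseteq> B})"
      using through_line by (intro sum.cong) (auto simp: T_def)
    finally show ?thesis by (simp add: e_def sum_distrib_left)
  qed
  have plane_bound: "s C * t C \<le> 2 * q * (\<Sum>B\<in>{B \<in> T. B \<subseteq> C}. card {A \<in> S. A \<subseteq> B})" if C: "C \<in> H" for C
  proof -
    interpret sparse_pair "between U C (dim U + 1)" "between U C (dim U + 2)" "(\<subseteq>)" q
      "F \<inter> between U C (dim U + 1)" "F \<inter> between U C (dim U + 2)"
      by (rule sparse_pair_between[OF F U HD(1,2,4)[OF C]])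
    have "s C * t C \<le> 2 * q * incidences"
      using product_le_incidences st[OF C] by (simp add: s_def t_def SC[OF C] TC[OF C])
    also have "incidences = (\<Sum>B\<in>{B \<in> T. B \<subseteq> C}. card {A \<in> S. A \<subseteq> B})"
      unfolding TC[OF C]
    proof (rule sum.cong[OF refl])
      fix B assume "B \<in> F \<inter> between U C (dim U + 2)"
      then have "{A \<in> S. A \<subseteq> B} = {A \<in> {A \<in> S. A \<subseteq> C}. A \<subseteq> B}" by (auto simp: between_iff)
      then show "card {A \<in> F \<inter> between U C (dim U + 1). A \<subseteq> B} = card {A \<in> S. A \<subseteq> B}"
        unfolding SC[OF C] by simp
    qed
    finally show ?thesis .
  qed
  have "(\<Sum>C\<in>H. s C * t C) \<le> (\<Sum>C\<in>H. 2 * q * (\<Sum>B\<in>{B \<in> T. B \<subseteq> C}. card {A \<in> S. A \<subseteq> B}))"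
    using plane_bound by (rule sum_mono)
  then have "(\<Sum>C\<in>H. s C * t C) \<le> 2 * q * ((q + 1) * e)"
    by (simp only: swap flip: sum_distrib_left)
  moreover have "(\<Sum>C\<in>H. s C * t C) + (\<Sum>C\<in>H. (s C)\<^sup>2) = (\<Sum>C\<in>H. s C * ?m)"
    unfolding sum.distrib[symmetric]
  proof (rule sum.cong[OF refl])
    fix C assume "C \<in> H"
    have "s C * t C + (s C)\<^sup>2 = s C * (s C + t C)" by (simp add: power2_eq_square algebra_simps)
    then show "s C * t C + (s C)\<^sup>2 = s C * ?m" unfolding st[OF \<open>C \<in> H\<close>] .
  qed
  moreover have "(\<Sum>C\<in>H. s C * ?m) = card S * ?m * ?m"
    using sum1 by (simp only: sum_distrib_right[symmetric])
  ultimately have nat_ineq: "card S * ?m * ?m \<le>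
      card S * ?m + card S * (card S - 1) * (q + 1) + 2 * q * ((q + 1) * e)"
    using sum2 by linarith
  have e_le: "e \<le> card S" "e \<le> card T"
  proof -
    have levels: "A = A'" if "A \<in> level i" "A' \<in> level i" "A \<subseteq> A' \<or> A' \<subseteq> A" for A A' i
      using that level_antichain[of A i A'] level_antichain[of A' i A] by auto
    have "card {A \<in> S. A \<subseteq> B} \<le> 1" if B: "B \<in> T" for B
    proof -
      have "A = A'" if "A \<in> S" "A' \<in> S" "A \<subseteq> B" "A' \<subseteq> B" for A A'
        using that B free_below[OF F, of B A A'] levels[of A "dim U + 1" A']
        by (simp add: S_def P_def T_def between_def)
      then show ?thesis by (simp add: card_le_Suc0_iff_eq)
    qed
    then have "e \<le> (\<Sum>B\<in>T. 1)" unfolding e_def by (rule sum_mono)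
    then show "e \<le> card T" by simp
    have one: "card {B \<in> T. A \<subseteq> B} \<le> 1" if A: "A \<in> S" for A
    proof -
      have "B = B'" if "B \<in> T" "B' \<in> T" "A \<subseteq> B" "A \<subseteq> B'" for B B'
        using that A free_above[OF F, of A B B'] levels[of B "dim U + 2" B']
        by (simp add: S_def P_def T_def between_def)
      then show ?thesis by (simp add: card_le_Suc0_iff_eq)
    qed
    have "e = (\<Sum>B\<in>T. \<Sum>A\<in>{A \<in> S. A \<subseteq> B}. 1)" by (simp add: e_def)
    also have "\<dots> = (\<Sum>A\<in>S. \<Sum>B\<in>{B \<in> T. A \<subseteq> B}. 1)" by (rule sum.swap_restrict) auto
    also have "\<dots> = (\<Sum>A\<in>S. card {B \<in> T. A \<subseteq> B})" by simp
    also have "\<dots> \<le> (\<Sum>A\<in>S. 1)" using one by (rule sum_mono)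
    finally show "e \<le> card S" by simp
  qed
  have S_le: "card S \<le> ?p" using card_mono[of P S] cardP by (simp add: S_def)
  define x y z r where "x = int (card S)" and "y = int (card T)" and "z = int e" and "r = int q"
  have pred: "int (card S * (card S - 1)) = x * (x - 1)"
    by (cases "card S") (simp_all add: x_def algebra_simps)
  have "int (card S * ?m * ?m) \<le>
      int (card S * ?m + card S * (card S - 1) * (q + 1) + 2 * q * ((q + 1) * e))"
    using nat_ineq by (simp only: of_nat_le_iff)
  moreover have "int (card S * ?m * ?m) = x * (r\<^sup>2 + r + 1) * (r\<^sup>2 + r + 1)"
    by (simp add: x_def r_def algebra_simps)
  moreover have "int (card S * ?m + card S * (card S - 1) * (q + 1) + 2 * q * ((q + 1) * e)) =
      x * (r\<^sup>2 + r + 1) + x * (x - 1) * (r + 1) + 2 * r * ((r + 1) * z)"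
    by (simp only: of_nat_add of_nat_mult[of "card S * (card S - 1)"] pred)
      (simp add: x_def r_def z_def algebra_simps)
  ultimately have "x * (r\<^sup>2 + r + 1) * (r\<^sup>2 + r + 1) \<le>
      x * (r\<^sup>2 + r + 1) + x * (x - 1) * (r + 1) + 2 * r * ((r + 1) * z)"
    by simp
  \<comment> \<open>With m = r^2 + r + 1 and p = r m + 1 the difference is x (m (m - 1) - (x - 1) (r
    + 1)), and m - 1 = r (r + 1) lets \<open>r + 1\<close> factor out, leaving x (p - x).\<close>
  then have "(r + 1) * (x * (r ^ 3 + r\<^sup>2 + r + 1 - x)) \<le> (r + 1) * (2 * r * z)"
    by (simp add: algebra_simps power2_eq_square power3_eq_cube)
  then have 1: "x * (r ^ 3 + r\<^sup>2 + r + 1 - x) \<le> 2 * r * z"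
    by (subst (asm) mult_le_cancel_left_pos) (simp_all add: r_def)
  have "int (card S * ?m + card T * (q + 1)) = int (?p * ?m)" by (simp only: T_eq)
  then have 2: "(r + 1) * y = (r\<^sup>2 + r + 1) * (r ^ 3 + r\<^sup>2 + r + 1 - x)"
    by (simp add: x_def y_def r_def algebra_simps)
  have 3: "x \<le> r ^ 3 + r\<^sup>2 + r + 1"
  proof -
    have "int (card S) \<le> int ?p" using S_le by (simp only: of_nat_le_iff)
    then show ?thesis by (simp add: x_def r_def)
  qed
  have "x = 0 \<or> x = r ^ 3 + r\<^sup>2 + r + 1"
    using e_le q_ge_2 by (intro rank4_arithmetic[OF _ _ 3 _ _ 2 1]) (auto simp: x_def y_def z_def r_def)
  then have "int (card S) = int 0 \<or> int (card S) = int ?p" by (auto simp: x_def r_def)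
  then have "card S = 0 \<or> card S = ?p" by (simp only: of_nat_eq_iff)
  then have "S = {} \<or> S = P" using card_subset_eq[of P S] cardP by (auto simp: S_def)
  then show ?thesis by (auto simp: S_def P_def)
qed

text \<open>Connectedness of the Grassmann graph. \<open>A\<close> is exchanged for the span of a
  hyperplane of \<open>A\<close> through \<open>A \<inter> B\<close> and a vector of
  \<open>B - A\<close>; the new subspace is adjacent to \<open>A\<close> and meets \<open>B\<close>
  in a larger dimension.\<close>

lemma level_connected:
  assumes closed: "\<And>A B. A \<in> S \<Longrightarrow> B \<in> level (Suc d) \<Longrightarrow> dim (A \<inter> B) = d \<Longrightarrow> B \<in> S"
    and S: "S \<subseteq> level (Suc d)" and A: "A \<in> S" and B: "B \<in> level (Suc d)"
  shows "B \<in> S"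
  using A
proof (induction "Suc d - dim (A \<inter> B)" arbitrary: A rule: less_induct)
  case less
  have Al: "subspace A" "dim A = Suc d" using less.prems S by (auto simp: level_iff)
  have Bl: "subspace B" "dim B = Suc d" using B by (auto simp: level_iff)
  have AB: "subspace (A \<inter> B)" using Al Bl by (simp add: subspace_inter)
  show ?case
  proof (cases "B \<subseteq> A")
    case True
    then show ?thesis using level_antichain[of B "Suc d" A] B S less.prems by auto
  next
    case False
    then obtain x where x: "x \<in> B" "x \<notin> A" by blast
    have "\<not> A \<subseteq> B" using False level_antichain[of A "Suc d" B] B S less.prems by auto
    then have "dim (A \<inter> B) \<noteq> Suc d"
      using subspace_eqI[of "A \<inter> B" A] AB Al by auto
    then have lt: "dim (A \<inter> B) \<le> d" using dim_subset[of "A \<inter> B" A] Al by simp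
    obtain H where "H \<in> between (A \<inter> B) A d"
      using exists_between[OF AB Al(1) Int_lower1 lt] Al(2) by auto
    then have H: "subspace H" "dim H = d" "A \<inter> B \<subseteq> H" "H \<subseteq> A"
      by (simp_all only: between_iff)
    have "x \<notin> H" using x H by blast
    then have dxH: "dim (insert x H) = Suc d" using dim_insert_notin[OF H(1)] H(2) by simp
    define A' where "A' = span (insert x H)"
    have A': "A' \<in> level (Suc d)" "H \<subseteq> A'" "x \<in> A'"
      using H x span_superset[of "insert x H"] dxH by (auto simp: A'_def level_iff)
    have "\<not> A \<subseteq> A'" using A' x level_antichain[of A "Suc d" A'] S less.prems by auto
    then have "dim (A \<inter> A') \<noteq> Suc d"
      using subspace_eqI[of "A \<inter> A'" A] A' Al by (auto simp: level_iff subspace_inter)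
    moreover have "dim (A \<inter> A') \<le> Suc d" using dim_subset[of "A \<inter> A'" A] Al by simp
    moreover have "d \<le> dim (A \<inter> A')" using dim_subset[of H "A \<inter> A'"] H A' by simp
    ultimately have "A' \<in> S" using closed[of A A'] less.prems A' by simp
    moreover have "Suc (dim (A \<inter> B)) \<le> dim (A' \<inter> B)"
    proof -
      have "insert x (A \<inter> B) \<subseteq> A' \<inter> B" using A' H x by auto
      then show ?thesis
        using dim_subset[of "insert x (A \<inter> B)" "A' \<inter> B"] dim_insert_notin[OF AB, of x] x by simp
    qed
    moreover have "dim (A' \<inter> B) \<le> Suc d" using dim_subset[of "A' \<inter> B" B] Bl by simp
    ultimately show ?thesis using less.hyps[of A'] lt by simp
  qed
qed

lemma extremal_odd:
  assumes n: "n = 2 * d + 3" "d \<ge> 1" and F: "free F" and max: "card F = card (level (d + 1))"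
  shows "F = level (d + 1) \<or> F = level (d + 2)"
proof -
  have mid: "F \<subseteq> level (d + 1) \<union> level (d + 2)"
    using extremal_middle(1) n F max by blast
  have closed: "B \<in> F \<inter> level (d + 1)"
    if A: "A \<in> F \<inter> level (d + 1)" and B: "B \<in> level (Suc d)" and AB: "dim (A \<inter> B) = d" for A B
  proof -
    let ?U = "A \<inter> B"
    have sub: "subspace A" "subspace B" "subspace ?U" "subspace (A + B)" "dim A = d + 1" "dim B = d + 1"
      using A B by (auto simp: level_iff subspace_inter subspace_plus)
    have "dim (A + B) = d + 2" using dim_plus[OF sub(1,2)] sub AB by simp
    \<comment> \<open>There is room for dimension \<open>d + 4\<close>, because
      \<open>d + 4 <= 2 * d + 3\<close> for \<open>d >= 1\<close>.\<close>
    then obtain W where W: "subspace W" "A + B \<subseteq> W" "dim W = d + 4"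
      using exists_between[OF sub(4) subspace_UNIV subset_UNIV, of "d + 4"] n
      by (auto simp: between_iff card_Basis)
    have le: "A \<subseteq> W" "B \<subseteq> W" using plus_upper[OF sub(1,2)] W by auto
    have "F \<inter> between ?U W (dim ?U + 1) = {} \<or> between ?U W (dim ?U + 1) \<subseteq> F"
    proof (rule rank4_homogeneous[OF F sub(3) W(1)])
      show "?U \<subseteq> W" using le by blast
      show "dim W = dim ?U + 4" using W AB by simp
      fix C assume "C \<in> between ?U W (dim ?U + 3)"
      then show "card (F \<inter> between ?U C (dim ?U + 1)) + card (F \<inter> between ?U C (dim ?U + 2)) = q\<^sup>2 + q + 1"
        using extremal_middle(2)[of d F ?U C] n F max sub(3) AB by (simp add: between_iff)
    qed
    moreover have "A \<in> F \<inter> between ?U W (dim ?U + 1)" "B \<in> between ?U W (dim ?U + 1)"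
      using A sub le AB by (auto simp: between_iff)
    ultimately show ?thesis using B by auto
  qed
  show ?thesis
  \<comment> \<open>Without points the family lies in level \<open>d + 2\<close>, which has the same
    size as level \<open>d + 1\<close> for odd \<open>n\<close>. A single point already spreads over
    all of level \<open>d + 1\<close>.\<close>
  proof (cases "F \<inter> level (d + 1) = {}")
    case True
    then have "F \<subseteq> level (d + 2)" using mid by blast
    then have "F = level (d + 2)"
      using card_middle_levels(1)[of d] n max by (intro card_subset_eq) auto
    then show ?thesis ..
  next
    case False
    then obtain A where A: "A \<in> F \<inter> level (d + 1)" by blast
    have "B \<in> F" if "B \<in> level (d + 1)" for B
      using level_connected[of "F \<inter> level (d + 1)" d A B] closed A that by auto
    then have "level (d + 1) = F" using max by (intro card_subset_eq) auto
    then show ?thesis by simp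
  qed
qed

end

section \<open>Small dimensions and the exceptional families\<close>

lemma card_3_members: "card S = 3 \<Longrightarrow> \<exists>a b c. S = {a, b, c} \<and> a \<noteq> b \<and> a \<noteq> c \<and> b \<noteq> c"
  by (auto simp: card_3_iff)

lemma card_le_1I:
  assumes "finite A" "\<And>x y. x \<in> A \<Longrightarrow> y \<in> A \<Longrightarrow> x = y"
  shows "card A \<le> 1"
  using assms by (simp add: card_le_Suc0_iff_eq)

context finite_geometry
begin

lemma between_0_UNIV: "between {0} UNIV i = level i"
  by (auto simp: between_def level_iff subspace_0)

subsection \<open>Dimension 2\<close>

text \<open>A family containing {0} or the whole space is a chain with at most 3 <= q + 1 members.
  For \<open>q = 2\<close> a full flag attains the bound as well, hence the condition in the second
  claim.\<close>

lemma free_rank2: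
  assumes n: "n = 2" and F: "free F"
  shows "card F \<le> q + 1" and "card F = q + 1 \<Longrightarrow> q \<noteq> 2 \<Longrightarrow> F = level 1"
proof -
  have c1: "card (level 1) = q + 1"
    using card_points_rank2[of "{0}" UNIV] n between_0_UNIV by (simp add: card_Basis)
  have chain: "card F \<le> 3" if C: "C \<in> F" "C = {0} \<or> C = UNIV" for C
  proof -
    have "A \<subseteq> B \<or> B \<subseteq> A" if "A \<in> F" "B \<in> F" for A B
      using free_comparable[OF F C(1) that] C(2) free_subspace[OF F] that subspace_0 by auto
    then have "inj_on dim F"
      using subspace_eqI free_subspace[OF F] by (metis inj_onI order_refl)
    then have "card F \<le> card {..2::nat}"
      using dim_le_n n by (intro card_inj_on_le[of dim]) auto
    then show ?thesis by simp
  qed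
  have "F \<subseteq> level 1" if "{0} \<notin> F" "UNIV \<notin> F"
  proof
    fix A assume A: "A \<in> F"
    then have sub: "A \<in> level (dim A)" using free_subspace[OF F] by (simp add: level_iff)
    have "dim A \<noteq> 0" using sub A that(1) level_0 by (metis singletonD)
    moreover have "dim A \<noteq> 2" using sub A that(2) level_n n by (metis singletonD)
    ultimately
    have "dim A = 1" using dim_le_n[of A] n by linarith
    then show "A \<in> level 1" using sub by simp
  qed
  then have cases: "card F \<le> 3 \<or> F \<subseteq> level 1" using chain by blast
  then show "card F \<le> q + 1"
    using card_mono[OF finite_level, of F 1] c1 q_ge_2 by auto
  assume "card F = q + 1" "q \<noteq> 2"
  then show "F = level 1"
    using cases c1 q_ge_2 card_subset_eq[OF finite_level, of F 1] by auto
qed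

subsection \<open>The exceptional families\<close>

abbreviation family1 where "family1 \<equiv> extra_family1 scale"

abbreviation family2 where "family2 \<equiv> extra_family2 scale"

section \<open>Triangles of points and their families\<close>

definition triangle :: "'b set \<Rightarrow> 'b set \<Rightarrow> 'b set \<Rightarrow> bool" where
  "triangle a b c \<longleftrightarrow> a \<in> level 1 \<and> b \<in> level 1 \<and> c \<in> level 1 \<and> a + b + c = UNIV"

lemma triangle_rotate: "triangle a b c \<Longrightarrow> triangle b c a"
  and triangle_swap: "triangle a b c \<Longrightarrow> triangle b a c"
  by (simp_all add: triangle_def add_ac)

lemma join_points:
  assumes "a \<in> level 1" "b \<in> level 1" "a \<noteq> b"
  shows "a + b \<in> level 2"
  using inter_points(2)[of "{0}" a UNIV b] assms by (simp add: between_0_UNIV level_iff subspace_plus)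

lemma line_eq_join:
  assumes "a \<in> level 1" "b \<in> level 1" "a \<noteq> b" "l \<in> level 2" "a \<subseteq> l" "b \<subseteq> l"
  shows "l = a + b"
proof -
  have "{B \<in> level 2. a \<subseteq> B \<and> b \<subseteq> B} = {a + b}"
    using lines_through_points_eq[of "{0}" UNIV a b] assms(1-3)
    by (simp add: between_0_UNIV flip: numeral_2_eq_2)
  then show ?thesis using assms(4-6) by blast
qed

lemma points_in_join: "a \<in> level 1 \<Longrightarrow> b \<in> level 1 \<Longrightarrow> a \<subseteq> a + b \<and> b \<subseteq> a + b"
  using plus_upper by (auto simp: level_iff)

lemma triangleI:
  assumes n: "n = 3" and abc: "a \<in> level 1" "b \<in> level 1" "c \<in> level 1" "a \<noteq> b" and c: "\<not> c \<subseteq> a + b"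
  shows "triangle a b c"
proof -
  have sub: "subspace (a + b)" "dim (a + b) = 2" "subspace c" "dim c = 1"
    using join_points[OF abc(1,2,4)] abc by (simp_all add: level_iff)
  have "dim ((a + b) \<inter> c) \<noteq> 1"
  proof
    assume "dim ((a + b) \<inter> c) = 1"
    then have "(a + b) \<inter> c = c"
      using sub by (intro subspace_eqI) (simp_all add: subspace_inter)
    then show False using c by blast
  qed
  moreover have "dim ((a + b) \<inter> c) \<le> 1"
    using dim_subset[of "(a + b) \<inter> c" c] sub by simp
  ultimately have "dim ((a + b) \<inter> c) = 0" by linarith
  then have "dim (a + b + c) = 3" using dim_plus[OF sub(1,3)] sub by linarith
  moreover have "dim UNIV = 3" using n by (simp add: card_Basis)
  ultimately have "a + b + c = UNIV"
    using subspace_eqI[of "a + b + c" UNIV] sub by (simp add: subspace_plus)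
  then show ?thesis using abc by (simp add: triangle_def)
qed

lemma triangleD:
  assumes n: "n = 3" and t: "triangle a b c"
  shows "a \<noteq> b" "a + b \<in> level 2" "\<not> c \<subseteq> a + b"
proof -
  have sub: "subspace a" "dim a = 1" "subspace b" "dim b = 1" "subspace c" "dim c = 1"
    "a + b + c = UNIV"
    using t by (auto simp: triangle_def level_iff)
  have ab: "subspace (a + b)" using sub by (simp add: subspace_plus)
  have "dim (a + b + c) = 3" using n sub by (simp add: card_Basis)
  then have le: "3 \<le> dim (a + b) + 1" using dim_plus[OF ab sub(5)] sub by linarith
  show "a \<noteq> b"
  proof
    assume "a = b"
    then have "a + b \<subseteq> a" using plus_least[of a b a] sub by simp
    then have "dim (a + b) \<le> 1" using dim_subset[of "a + b" a] sub by simp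
    then show False using le by simp
  qed
  then show "a + b \<in> level 2" using join_points t by (simp add: triangle_def)
  then have "dim (a + b) = 2" by (simp add: level_iff)
  show "\<not> c \<subseteq> a + b"
  proof
    assume "c \<subseteq> a + b"
    then have "a + b + c \<subseteq> a + b" using plus_least[OF ab sub(5) ab] by simp
    then show False
      using dim_subset[of "a + b + c" "a + b"] \<open>dim (a + b) = 2\<close> \<open>dim (a + b + c) = 3\<close> by simp
  qed
qed

lemma triangle_points:
  assumes "n = 3" "triangle a b c"
  shows "a \<in> level 1" "b \<in> level 1" "c \<in> level 1" "a \<noteq> b" "a \<noteq> c" "b \<noteq> c"
  using assms triangleD(1)[OF assms(1)] triangle_rotate triangle_def by metis+

lemma triangle_lines:
  assumes "n = 3" "triangle a b c"
  shows "a + b \<in> level 2" "a + c \<in> level 2" "b + c \<in> level 2"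
    "a + b \<noteq> a + c" "a + b \<noteq> b + c" "a + c \<noteq> b + c"
    "\<not> c \<subseteq> a + b" "\<not> b \<subseteq> a + c" "\<not> a \<subseteq> b + c"
proof -
  have t: "triangle b c a" "triangle c a b" using assms triangle_rotate by blast+
  show *: "a + b \<in> level 2" "a + c \<in> level 2" "b + c \<in> level 2"
    "\<not> c \<subseteq> a + b" "\<not> b \<subseteq> a + c" "\<not> a \<subseteq> b + c"
    using triangleD[OF assms] triangleD[OF assms(1) t(1)] triangleD[OF assms(1) t(2)]
    by (simp_all add: add.commute)
  show "a + b \<noteq> a + c" "a + b \<noteq> b + c" "a + c \<noteq> b + c"
    using * points_in_join triangle_points[OF assms] by metis+
qed

lemma plane_rank3: "n = 3 \<Longrightarrow> projective_plane (level 1) (level 2) (\<subseteq>) q"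
  using projective_plane_between[of "{0}" UNIV] by (simp add: between_0_UNIV card_Basis flip: numeral_2_eq_2)

lemma card_family1:
  assumes "n = 3" "triangle a b c"
  shows "card (family1 a b c) = card (level 1)" "card (family1 a b c \<inter> level 1) = card (level 1) - 3"
proof -
  note p = triangle_points[OF assms] and l = triangle_lines[OF assms]
  have "A \<notin> level 1" if "A \<in> level 2" for A using that by (simp add: level_iff)
  then have l1: "a + b \<notin> level 1" "a + c \<notin> level 1" "b + c \<notin> level 1" using l(1-3) by simp_all
  then have dis: "{a + b, a + c, b + c} \<inter> (level 1 - {a, b, c}) = {}" by simp
  have c3: "card (level 1 - {a, b, c}) = card (level 1) - 3"
    using p by (simp add: card_Diff_subset)
  have "family1 a b c \<inter> level 1 = level 1 - {a, b, c}"
    using l1 by (simp add: extra_family1_def Int_Un_distrib2 Int_absorb2)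
  then show "card (family1 a b c \<inter> level 1) = card (level 1) - 3" using c3 by simp
  have "card {a, b, c} \<le> card (level 1)" using p by (intro card_mono) auto
  then have "3 \<le> card (level 1)" using p by simp
  moreover have "card (family1 a b c) = card {a + b, a + c, b + c} + card (level 1 - {a, b, c})"
    unfolding extra_family1_def by (rule card_Un_disjoint) (use dis in auto)
  ultimately show "card (family1 a b c) = card (level 1)"
    using l c3 by simp
qed

lemma card_family2:
  assumes "n = 3" "triangle a b c"
  shows "card (family2 a b c) = card (level 2)" "card (family2 a b c \<inter> level 1) = 3"
proof -
  note p = triangle_points[OF assms] and l = triangle_lines[OF assms]
  have dis': "A \<notin> level 2" if "A \<in> level 1" for A using that by (simp add: level_iff)
  then have dis: "{a, b, c} \<inter> (level 2 - {a + b, a + c, b + c}) = {}" using p(1-3) by simp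
  have "family2 a b c \<inter> level 1 = {a, b, c}"
    using dis' p(1-3) unfolding extra_family2_def by blast
  then show "card (family2 a b c \<inter> level 1) = 3" using p by simp
  have "card {a + b, a + c, b + c} \<le> card (level 2)" using l by (intro card_mono) auto
  then have "3 \<le> card (level 2)" using l by simp
  moreover have "card (level 2 - {a + b, a + c, b + c}) = card (level 2) - 3"
    using l by (simp add: card_Diff_subset)
  moreover have "card (family2 a b c) = card {a, b, c} + card (level 2 - {a + b, a + c, b + c})"
    unfolding extra_family2_def by (rule card_Un_disjoint) (use dis in auto)
  ultimately show "card (family2 a b c) = card (level 2)"
    using p by simp
qed

text \<open>For \<open>q = 2\<close> a line has three points, so a side has just one point besides
  its two vertices; two sides meet in a vertex, so no other point lies on both.\<close>

lemma free_family1: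
  assumes n: "n = 3" and q: "q = 2" and t: "triangle a b c"
  shows "free (family1 a b c)"
proof -
  interpret projective_plane "level 1" "level 2" "(\<subseteq>)" q using plane_rank3[OF n] .
  note p = triangle_points[OF n t] and l = triangle_lines[OF n t]
  note up = points_in_join[OF p(1,2)] points_in_join[OF p(1,3)] points_in_join[OF p(2,3)]
  have few: "card {A \<in> level 1 - {a, b, c}. A \<subseteq> B} \<le> 1"
    if "B \<in> level 2" "x \<in> {a, b, c}" "y \<in> {a, b, c}" "x \<noteq> y" "x \<subseteq> B" "y \<subseteq> B" for B x y
  proof -
    have "{A \<in> level 1 - {a, b, c}. A \<subseteq> B} \<subseteq> {A \<in> level 1. A \<subseteq> B} - {x, y}" using that by blast
    then have "card {A \<in> level 1 - {a, b, c}. A \<subseteq> B} \<le> card ({A \<in> level 1. A \<subseteq> B} - {x, y})"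
      by (intro card_mono) auto
    also have "\<dots> = card {A \<in> level 1. A \<subseteq> B} - card {x, y}"
      using that p by (intro card_Diff_subset) auto
    finally show ?thesis using points_on_line[OF that(1)] that(4) q by simp
  qed
  have one: "A = x"
    if "A \<in> level 1" "x \<in> level 1" "B \<in> level 2" "B' \<in> level 2" "B \<noteq> B'"
      "x \<subseteq> B" "x \<subseteq> B'" "A \<subseteq> B" "A \<subseteq> B'" for A x B B'
  proof -
    note unique = point_on_lines[OF that(3-5)]
    obtain z where z: "{p \<in> level 1. p \<subseteq> B \<and> p \<subseteq> B'} = {z}"
      using unique by (rule card_1_singletonE)
    have "A \<in> {p \<in> level 1. p \<subseteq> B \<and> p \<subseteq> B'}" "x \<in> {p \<in> level 1. p \<subseteq> B \<and> p \<subseteq> B'}"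
      using that by simp_all
    then show ?thesis unfolding z by simp
  qed
  have "free ((level 1 - {a, b, c}) \<union> {a + b, a + c, b + c})"
  proof (rule free_two_levels[of _ 1 _ 2])
    fix B assume "B \<in> {a + b, a + c, b + c}"
    then show "card {A \<in> level 1 - {a, b, c}. A \<subseteq> B} \<le> 1"
      using few[of "a + b" a b] few[of "a + c" a c] few[of "b + c" b c] p l up by auto
  next
    fix A assume A: "A \<in> level 1 - {a, b, c}"
    have eq: "B = B'" if "B \<in> {a + b, a + c, b + c}" "B' \<in> {a + b, a + c, b + c}" "A \<subseteq> B" "A \<subseteq> B'" for B B'
    proof (rule ccontr)
      assume "B \<noteq> B'"
      then have "\<exists>x\<in>{a, b, c}. x \<subseteq> B \<and> x \<subseteq> B'"
        using that(1,2) up by (elim insertE emptyE) simp_all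
      then obtain x where x: "x \<in> {a, b, c}" "x \<subseteq> B" "x \<subseteq> B'" by blast
      then have "x \<in> level 1" using p(1-3) by blast
      moreover have "B \<in> level 2" "B' \<in> level 2" using that(1,2) l(1-3) by blast+
      moreover have "A \<in> level 1" "A \<noteq> x" using A x(1) by blast+
      ultimately show False using one[of A x B B'] x(2,3) that(3,4) \<open>B \<noteq> B'\<close> by simp
    qed
    show "card {B \<in> {a + b, a + c, b + c}. A \<subseteq> B} \<le> 1"
      by (intro card_le_1I eq) simp_all
  qed (use l in auto)
  then show ?thesis by (simp add: extra_family1_def Un_commute)
qed

text \<open>The dual argument: two of the three lines through a vertex are sides, and a line through
  two vertices is a side.\<close>

lemma free_family2:
  assumes n: "n = 3" and q: "q = 2" and t: "triangle a b c"
  shows "free (family2 a b c)"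
proof -
  interpret projective_plane "level 1" "level 2" "(\<subseteq>)" q using plane_rank3[OF n] .
  note p = triangle_points[OF n t] and l = triangle_lines[OF n t]
  note up = points_in_join[OF p(1,2)] points_in_join[OF p(1,3)] points_in_join[OF p(2,3)]
  have few: "card {B \<in> level 2 - {a + b, a + c, b + c}. A \<subseteq> B} \<le> 1"
    if "A \<in> level 1" "x \<in> {a + b, a + c, b + c}" "y \<in> {a + b, a + c, b + c}" "x \<noteq> y" "A \<subseteq> x" "A \<subseteq> y" for A x y
  proof -
    have "{B \<in> level 2 - {a + b, a + c, b + c}. A \<subseteq> B} \<subseteq> {B \<in> level 2. A \<subseteq> B} - {x, y}" using that by blast
    then have "card {B \<in> level 2 - {a + b, a + c, b + c}. A \<subseteq> B} \<le> card ({B \<in> level 2. A \<subseteq> B} - {x, y})"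
      by (intro card_mono) auto
    also have "\<dots> = card {B \<in> level 2. A \<subseteq> B} - card {x, y}"
      using that l by (intro card_Diff_subset) auto
    finally show ?thesis using lines_through_point[OF that(1)] that(4) q by simp
  qed
  have "free ({a, b, c} \<union> (level 2 - {a + b, a + c, b + c}))"
  proof (rule free_two_levels[of _ 1 _ 2])
    fix A assume "A \<in> {a, b, c}"
    then show "card {B \<in> level 2 - {a + b, a + c, b + c}. A \<subseteq> B} \<le> 1"
      using few[of a "a + b" "a + c"] few[of b "a + b" "b + c"] few[of c "a + c" "b + c"] p l up by auto
  next
    fix B assume B: "B \<in> level 2 - {a + b, a + c, b + c}"
    have eq: "x = y" if "x \<in> {a, b, c}" "y \<in> {a, b, c}" "x \<subseteq> B" "y \<subseteq> B" for x y
    proof (rule ccontr)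
      assume "x \<noteq> y"
      have xy: "x \<in> level 1" "y \<in> level 1" using that(1,2) p(1-3) by blast+
      have "B = x + y" using line_eq_join[OF xy \<open>x \<noteq> y\<close> _ that(3,4)] B by blast
      moreover have "x + y \<in> {a + b, a + c, b + c}"
        using that(1,2) \<open>x \<noteq> y\<close> by (elim insertE emptyE) (simp_all add: add.commute)
      ultimately show False using B by simp
    qed
    show "card {A \<in> {a, b, c}. A \<subseteq> B} \<le> 1"
      by (intro card_le_1I eq) simp_all
  qed (use p in auto)
  then show ?thesis by (simp add: extra_family2_def)
qed

text \<open>Each join of two of the points lies outside \<open>T\<close> and, by
  \<open>compl\<close>, contains exactly two of them. So the points are not collinear, and the three
  joins exhaust the complement of \<open>T\<close>.\<close>

lemma triangle_family_of_points:
  assumes n: "n = 3" and p: "a \<in> level 1" "b \<in> level 1" "c \<in> level 1" "a \<noteq> b" "a \<noteq> c" "b \<noteq> c"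
    and T: "T \<subseteq> level 2" "card (level 2 - T) = 3"
    and compl: "\<And>l. l \<in> level 2 \<Longrightarrow> l \<notin> T \<longleftrightarrow> card {p \<in> {a, b, c}. p \<subseteq> l} = 2"
    and few: "\<And>l. l \<in> T \<Longrightarrow> card {p \<in> {a, b, c}. p \<subseteq> l} \<le> 1"
  shows "triangle a b c \<and> {a, b, c} \<union> T = family2 a b c"
proof -
  have join: "x + y \<in> level 2 - T \<and> \<not> {a, b, c} \<subseteq> {p. p \<subseteq> x + y}"
    if xy: "x \<in> {a, b, c}" "y \<in> {a, b, c}" "x \<noteq> y" for x y
  proof -
    have l: "x + y \<in> level 2" "x \<subseteq> x + y" "y \<subseteq> x + y"
    proof -
      have "x \<in> level 1" "y \<in> level 1" using xy(1,2) p(1-3) by blast+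
      then show "x + y \<in> level 2" "x \<subseteq> x + y" "y \<subseteq> x + y"
        using join_points points_in_join xy(3) by blast+
    qed
    have "card {x, y} \<le> card {p \<in> {a, b, c}. p \<subseteq> x + y}" using xy l by (intro card_mono) auto
    then have notin: "x + y \<notin> T" using few[of "x + y"] xy by auto
    then have "card {p \<in> {a, b, c}. p \<subseteq> x + y} = 2" using compl l by blast
    moreover have "card {p \<in> {a, b, c}. p \<subseteq> x + y} = 3" if "{a, b, c} \<subseteq> {p. p \<subseteq> x + y}"
    proof -
      have "{p \<in> {a, b, c}. p \<subseteq> x + y} = {a, b, c}" using that by blast
      then show ?thesis using p by simp
    qed
    ultimately show ?thesis using notin l(1) by force
  qed
  have "\<not> c \<subseteq> a + b" using join[of a b] points_in_join[OF p(1,2)] p by auto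
  then have t: "triangle a b c" using triangleI[OF n] p by blast
  note l = triangle_lines[OF n t]
  have "{a + b, a + c, b + c} = level 2 - T"
    using join[of a b] join[of a c] join[of b c] p l T by (intro card_subset_eq) auto
  then have "T = level 2 - {a + b, a + c, b + c}" using T by blast
  then show ?thesis using t by (simp add: extra_family2_def)
qed

lemma meet_lines:
  assumes "n = 3" "l \<in> level 2" "l' \<in> level 2" "l \<noteq> l'"
  shows "l \<inter> l' \<in> level 1"
proof -
  have "{p \<in> level 1. p \<subseteq> l \<and> p \<subseteq> l'} = {l \<inter> l'}"
    using inter_lines[of "{0}" UNIV l l'] assms
    by (simp add: between_0_UNIV card_Basis flip: numeral_2_eq_2)
  then show ?thesis by blast
qed

text \<open>The vertices are the pairwise intersections of the lines: each lies outside
  \<open>S\<close> and, by \<open>compl\<close>, on exactly two of the lines, which are therefore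
  the sides of a triangle.\<close>

lemma triangle_family_of_lines:
  assumes n: "n = 3" and l: "l1 \<in> level 2" "l2 \<in> level 2" "l3 \<in> level 2" "l1 \<noteq> l2" "l1 \<noteq> l3" "l2 \<noteq> l3"
    and S: "S \<subseteq> level 1" "card (level 1 - S) = 3"
    and compl: "\<And>p. p \<in> level 1 \<Longrightarrow> p \<notin> S \<longleftrightarrow> card {l \<in> {l1, l2, l3}. p \<subseteq> l} = 2"
    and few: "\<And>p. p \<in> S \<Longrightarrow> card {l \<in> {l1, l2, l3}. p \<subseteq> l} \<le> 1"
  shows "\<exists>a b c. triangle a b c \<and> S \<union> {l1, l2, l3} = family1 a b c"
proof -
  have meet: "x \<inter> y \<in> level 1 - S \<and> \<not> {l1, l2, l3} \<subseteq> {l. x \<inter> y \<subseteq> l}"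
    if xy: "x \<in> {l1, l2, l3}" "y \<in> {l1, l2, l3}" "x \<noteq> y" for x y
  proof -
    have "x \<in> level 2" "y \<in> level 2" using xy(1,2) l(1-3) by blast+
    then have "x \<inter> y \<in> level 1" using meet_lines[OF n] xy(3) by blast
    moreover have "card {x, y} \<le> card {l \<in> {l1, l2, l3}. x \<inter> y \<subseteq> l}" using xy by (intro card_mono) auto
    ultimately have notin: "x \<inter> y \<in> level 1" "x \<inter> y \<notin> S" using few[of "x \<inter> y"] xy by auto
    then have "card {l \<in> {l1, l2, l3}. x \<inter> y \<subseteq> l} = 2" using compl by blast
    moreover have "card {l \<in> {l1, l2, l3}. x \<inter> y \<subseteq> l} = 3" if "{l1, l2, l3} \<subseteq> {l. x \<inter> y \<subseteq> l}"
    proof -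
      have "{l \<in> {l1, l2, l3}. x \<inter> y \<subseteq> l} = {l1, l2, l3}" using that by blast
      then show ?thesis using l by simp
    qed
    ultimately show ?thesis using notin by force
  qed
  define a b c where "a = l1 \<inter> l2" and "b = l1 \<inter> l3" and "c = l2 \<inter> l3"
  have p: "a \<in> level 1 - S" "b \<in> level 1 - S" "c \<in> level 1 - S"
    and n3: "\<not> a \<subseteq> l3" "\<not> b \<subseteq> l2" "\<not> c \<subseteq> l1"
    using meet[of l1 l2] meet[of l1 l3] meet[of l2 l3] l by (auto simp: a_def b_def c_def)
  have ne: "a \<noteq> b" "a \<noteq> c" "b \<noteq> c" using n3 by (auto simp: a_def b_def c_def)
  have L: "l1 = a + b" "l2 = a + c" "l3 = b + c"
    using line_eq_join[of a b l1] line_eq_join[of a c l2] line_eq_join[of b c l3] p ne l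
    by (auto simp: a_def b_def c_def)
  have t: "triangle a b c" using triangleI[OF n, of a b c] p ne n3(3) L(1) by simp
  have "{a, b, c} = level 1 - S"
    using p ne S by (intro card_subset_eq) auto
  then have "S = level 1 - {a, b, c}" using S by blast
  then have "S \<union> {l1, l2, l3} = family1 a b c" unfolding L by (auto simp: extra_family1_def)
  then show ?thesis using t by blast
qed

text \<open>Now the plane [{0}, UNIV] is the whole geometry. A mixed family has 3 points and 4 lines
  or the reverse; the second case uses \<open>mixed_complement\<close> of the dual pair.\<close>

lemma extremal_rank3:
  assumes n: "n = 3" and F: "free F" and max: "card F = card (level 1)"
  shows "F = level 1 \<or> F = level 2 \<or> q = 2 \<and> (\<exists>a b c. triangle a b c \<and> (F = family1 a b c \<or> F = family2 a b c))"
proof -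
  define S T where "S = F \<inter> level 1" and "T = F \<inter> level 2"
  have c21: "card (level 2) = card (level 1)" using card_middle_levels(1)[of 0] n by (simp flip: numeral_2_eq_2)
  have "F \<subseteq> level 1 \<union> level 2"
    using extremal_middle(1)[of 0 F] n F max by (simp flip: numeral_2_eq_2)
  then have FU: "F = S \<union> T" unfolding S_def T_def by blast
  have "card S + card T = q\<^sup>2 + q + 1"
    using extremal_middle(2)[of 0 F "{0}" UNIV] n F max
    by (simp add: S_def T_def between_0_UNIV card_Basis flip: numeral_2_eq_2)
  interpret sparse_pair "level 1" "level 2" "(\<subseteq>)" q S T
    using sparse_pair_between[OF F, of "{0}" UNIV] n
    by (simp add: S_def T_def between_0_UNIV card_Basis flip: numeral_2_eq_2)
  interpret d: sparse_pair "level 2" "level 1" "\<lambda>l p. p \<subseteq> l" q T S by (rule dual_pair)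
  consider "S = {}" | "T = {}" | "S \<noteq> {}" "T \<noteq> {}" by blast
  then show ?thesis
  proof cases
    case 1
    then have "F = level 2" using FU max c21 by (intro card_subset_eq) (auto simp: T_def)
    then show ?thesis by simp
  next
    case 2
    then have "F = level 1" using FU max by (intro card_subset_eq) (auto simp: S_def)
    then show ?thesis by simp
  next
    case 3
    note st = \<open>card S + card T = q\<^sup>2 + q + 1\<close>
    note m = mixed_imp[OF 3 eq_refl[OF st[symmetric]]]
    have c7: "card (level 1) = 7" "card (level 2) = 7" using card_points card_lines m(1) by auto
    from m(2) show ?thesis
    proof
      assume *: "card S = 3 \<and> card T = 4"
      then obtain a b c where abc: "S = {a, b, c}" "a \<noteq> b" "a \<noteq> c" "b \<noteq> c" using card_3_members by metis
      have "triangle a b c \<and> {a, b, c} \<union> T = family2 a b c"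
      proof (rule triangle_family_of_points[OF n])
        show "card (level 2 - T) = 3" using * c7 T_sub finite_T by (simp add: card_Diff_subset)
        show "l \<notin> T \<longleftrightarrow> card {p \<in> {a, b, c}. p \<subseteq> l} = 2" if "l \<in> level 2" for l
          using mixed_complement[OF 3(2) st _ that] * abc by simp
        show "card {p \<in> {a, b, c}. p \<subseteq> l} \<le> 1" if "l \<in> T" for l
          using few_points[OF that] abc by simp
      qed (use abc S_sub T_sub in auto)
      then show ?thesis using FU abc(1) m(1) by blast
    next
      assume *: "card S = 4 \<and> card T = 3"
      then obtain a b c where abc: "T = {a, b, c}" "a \<noteq> b" "a \<noteq> c" "b \<noteq> c" using card_3_members by metis
      have "\<exists>x y z. triangle x y z \<and> S \<union> {a, b, c} = family1 x y z"
      proof (rule triangle_family_of_lines[OF n])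
        show "card (level 1 - S) = 3" using * c7 S_sub finite_S by (simp add: card_Diff_subset)
        show "p \<notin> S \<longleftrightarrow> card {l \<in> {a, b, c}. p \<subseteq> l} = 2" if "p \<in> level 1" for p
          using d.mixed_complement[OF 3(1) _ _ that] st * abc by (simp add: add.commute)
        show "card {l \<in> {a, b, c}. p \<subseteq> l} \<le> 1" if "p \<in> S" for p
          using few_lines[OF that] abc by simp
      qed (use abc S_sub T_sub in auto)
      then show ?thesis using FU abc(1) m(1) by blast
    qed
  qed
qed

subsection \<open>Equivalence of the exceptional families\<close>

lemma point_generator:
  assumes "a \<in> level 1"
  obtains u where "a = span {u}"
proof -
  obtain B where B: "B \<subseteq> a" "independent B" "a \<subseteq> span B" "card B = dim a" using basis_exists by blast
  then obtain u where "B = {u}" using assms by (auto simp: level_iff card_1_singleton_iff)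
  then show ?thesis using that[of u] span_subspace[OF B(1,3)] assms by (simp add: level_iff)
qed

text \<open>Generators of the three points span a space of dimension 3, so they form a basis. This
  makes \<open>GL\<close> transitive on triangles.\<close>

lemma triangle_basis:
  assumes n: "n = 3" and t: "triangle a b c"
  obtains u v w where "a = span {u}" "b = span {v}" "c = span {w}"
    "independent {u, v, w}" "u \<noteq> v" "u \<noteq> w" "v \<noteq> w"
proof -
  obtain u v w where uvw: "a = span {u}" "b = span {v}" "c = span {w}"
    using t point_generator by (metis triangle_def)
  have "a + b + c \<subseteq> span {u, v, w}"
    unfolding uvw by (intro plus_least subspace_plus subspace_span span_mono) auto
  then have sp: "UNIV \<subseteq> span {u, v, w}" using t by (simp add: triangle_def)
  then have "3 \<le> card {u, v, w}" using dim_le_card[OF sp] n by (simp add: card_Basis)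
  moreover have "card {u, v, w} \<le> 3" by (simp add: card_insert_if)
  ultimately have c3: "card {u, v, w} = 3" by simp
  then have "independent {u, v, w}"
    using card_eq_dim[of "{u, v, w}" UNIV] sp n by (simp add: card_Basis)
  moreover have "u \<noteq> v" "u \<noteq> w" "v \<noteq> w" using c3 by (auto simp: card_insert_if split: if_splits)
  ultimately show ?thesis using that uvw by blast
qed

lemma triangle_transitive:
  assumes n: "n = 3" and t: "triangle a b c" "triangle a' b' c'"
  obtains g where "g \<in> GL" "g ` a = a'" "g ` b = b'" "g ` c = c'"
proof -
  obtain u v w where B: "a = span {u}" "b = span {v}" "c = span {w}"
    "independent {u, v, w}" "u \<noteq> v" "u \<noteq> w" "v \<noteq> w"
    using triangle_basis[OF n t(1)] .
  obtain u' v' w' where B': "a' = span {u'}" "b' = span {v'}" "c' = span {w'}"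
    "independent {u', v', w'}" "u' \<noteq> v'" "u' \<noteq> w'" "v' \<noteq> w'"
    using triangle_basis[OF n t(2)] .
  define f where "f x = (if x = u then u' else if x = v then v' else w')" for x
  have f: "f u = u'" "f v = v'" "f w = w'" using B by (auto simp: f_def)
  obtain g where g: "g \<in> GL" "\<And>x. x \<in> {u, v, w} \<Longrightarrow> g x = f x"
    using extend_to_GL[of "{u, v, w}" f] B B' f by (auto simp: inj_on_def)
  interpret g: Vector_Spaces.linear scale scale g using g by (simp add: GL_def)
  have "g ` span {x} = span {f x}" if "x \<in> {u, v, w}" for x
    using g(2)[OF that] by (simp flip: g.span_image)
  then show ?thesis using that[OF g(1)] f B B' by simp
qed

lemma GL_image_levels: "g \<in> GL \<Longrightarrow> (\<lambda>A. g ` A) ` level i = level i"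
  using GL_image_level[of g] inj_GL_image[of g] by (intro endo_inj_surj) auto

lemma GL_image_plus:
  assumes "g \<in> GL"
  shows "g ` (A + B) = g ` A + g ` B"
proof -
  interpret g: Vector_Spaces.linear scale scale g using assms by (simp add: GL_def)
  show ?thesis by (force simp: set_plus_def g.add image_iff)
qed

lemma GL_image_family:
  assumes g: "g \<in> GL"
  shows "(\<lambda>A. g ` A) ` family1 a b c = family1 (g ` a) (g ` b) (g ` c)"
    and "(\<lambda>A. g ` A) ` family2 a b c = family2 (g ` a) (g ` b) (g ` c)"
  using inj_GL_image[OF g, of UNIV] GL_image_levels[OF g]
  by (simp_all add: extra_family1_def extra_family2_def image_Un image_set_diff GL_image_plus[OF g])

lemma equivalent_families_iff:
  "equivalent_families scale F G \<longleftrightarrow> (\<exists>g\<in>GL. G = (\<lambda>A. g ` A) ` F)"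
  by (auto simp: equivalent_families_def GL_def)

lemma equivalent_triangle_families:
  assumes "n = 3" "triangle a b c" "triangle a' b' c'"
  shows "equivalent_families scale (family1 a b c) (family1 a' b' c')"
    and "equivalent_families scale (family2 a b c) (family2 a' b' c')"
proof -
  obtain g where "g \<in> GL" "g ` a = a'" "g ` b = b'" "g ` c = c'" using triangle_transitive[OF assms] .
  then show "equivalent_families scale (family1 a b c) (family1 a' b' c')"
    "equivalent_families scale (family2 a b c) (family2 a' b' c')"
    unfolding equivalent_families_iff using GL_image_family by metis+
qed

lemma equivalent_card_level:
  assumes "equivalent_families scale F G"
  shows "card (G \<inter> level i) = card (F \<inter> level i)"
proof -
  obtain g where g: "g \<in> GL" "G = (\<lambda>A. g ` A) ` F" using assms by (auto simp: equivalent_families_iff)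
  have "(\<lambda>A. g ` A) ` (F \<inter> level i) = (\<lambda>A. g ` A) ` F \<inter> (\<lambda>A. g ` A) ` level i"
    using inj_GL_image[OF g(1), of UNIV] by (rule image_Int)
  then have "(\<lambda>A. g ` A) ` (F \<inter> level i) = G \<inter> level i"
    using GL_image_levels[OF g(1)] g(2) by simp
  then show ?thesis using card_image[OF inj_GL_image[OF g(1)]] by metis
qed

text \<open>A linear bijection preserves the number of members of each dimension, and the families
  have 4 and 3 points.\<close>

lemma families_not_equivalent:
  assumes "n = 3" "q = 2" "triangle a b c"
  shows "\<not> equivalent_families scale (family1 a b c) (family2 a b c)"
proof
  assume "equivalent_families scale (family1 a b c) (family2 a b c)"
  then have "card (level 1) - 3 = 3"
    using equivalent_card_level[of "family1 a b c" "family2 a b c" 1] card_family1(2) card_family2(2) assms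
    by simp
  moreover have "card (level 1) = 7"
    using projective_plane.card_points[OF plane_rank3[OF assms(1)]] assms by simp
  ultimately show False by simp
qed

subsection \<open>Maximum size and extremal families\<close>

lemma free_card_le_middle:
  assumes "n \<ge> 2" "free F"
  shows "card F \<le> card (level (n div 2))"
proof -
  consider "n = 2" | d where "n = 2 * d + 2" "d \<ge> 1" | d where "n = 2 * d + 3"
  proof (cases "even n")
    case True
    then obtain k where "n = 2 * k" by blast
    then show ?thesis using that(1) that(2)[of "k - 1"] assms(1) by (cases "k = 1") auto
  next
    case False
    then obtain k where "n = 2 * k + 1" using oddE by blast
    then show ?thesis using that(3)[of "k - 1"] assms(1) by auto
  qed
  then show ?thesis
  proof cases
    case 1
    then show ?thesis
      using free_rank2(1)[OF 1 assms(2)] card_points_rank2[of "{0}" UNIV]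
      by (simp add: between_0_UNIV card_Basis)
  next
    case 2
    then show ?thesis using free_card_le[of d F] assms by simp
  next
    case 3
    then have "n div 2 = d + 1" by simp
    then show ?thesis using free_card_le[of d F] assms 3 by simp
  qed
qed

lemma La_star_eq:
  assumes "n \<ge> 2"
  shows "La_star scale {V_poset, Lambda_poset} = card (level (n div 2))"
  unfolding La_star_def
proof (rule Max_eqI)
  have "{card F |F. free F} = card ` {F. free F}" by blast
  moreover have "finite {F. free F}"
    by (rule finite_subset[of _ "Pow UNIV"]) (auto simp del: Pow_UNIV)
  ultimately show "finite {card F |F. free F}" by simp
qed (use free_card_le_middle[OF assms] free_level in auto)

lemma extremal_iff:
  assumes n: "n \<ge> 2"
  shows "extremal_family scale {V_poset, Lambda_poset} F \<longleftrightarrow> free F \<and> card F = card (level (n div 2))"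
  using La_star_eq[OF n] by (simp add: extremal_family_def)

lemma extremal_characterization:
  assumes n: "n \<ge> 2" and not22: "(n, q) \<noteq> (2, 2)"
  shows "extremal_family scale {V_poset, Lambda_poset} F \<longleftrightarrow>
    F = level (n div 2) \<or> F = level (nat \<lceil>real n / 2\<rceil>) \<or>
    n = 3 \<and> q = 2 \<and> (\<exists>a b c. triangle a b c \<and> (F = family1 a b c \<or> F = family2 a b c))"
    (is "_ \<longleftrightarrow> ?R")
  unfolding extremal_iff[OF n]
proof
  assume F: "free F \<and> card F = card (level (n div 2))"
  show ?R
  proof (cases "even n")
    case True
    then obtain k where k: "n = 2 * k" by blast
    show ?thesis
    proof (cases "k = 1")
      case True
      have "card (level 1) = q + 1"
        using card_points_rank2[of "{0}" UNIV] k True by (simp add: between_0_UNIV card_Basis)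
      then have "F = level 1" using free_rank2(2)[of F] F k True not22 by auto
      then show ?thesis using k True by simp
    next
      case False
      then have "F = level (k - 1 + 1)" using F k n by (intro extremal_even) auto
      then show ?thesis using k False n by simp
    qed
  next
    case False
    then obtain k where k: "n = 2 * k + 1" using oddE by blast
    have c: "nat \<lceil>real n / 2\<rceil> = k + 1" using k by (simp add: add_divide_distrib ceiling_unique) linarith
    show ?thesis
    proof (cases "k = 1")
      case True
      then have "n = 3" "n div 2 = 1" "nat \<lceil>real n / 2\<rceil> = 2" using k c by auto
      then show ?thesis using extremal_rank3[of F] F by metis
    next
      case False
      then have "F = level (k - 1 + 1) \<or> F = level (k - 1 + 2)" using F k n by (intro extremal_odd) auto
      then show ?thesis using k False n c by auto
    qed
  qed
next
  assume ?R
  moreover have "card (level (nat \<lceil>real n / 2\<rceil>)) = card (level (n div 2))"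
  proof (cases "even n")
    case True
    then show ?thesis by (auto elim!: evenE)
  next
    case False
    then obtain k where k: "n = 2 * k + 1" using oddE by blast
    have "nat \<lceil>real n / 2\<rceil> = k + 1" using k by (simp add: add_divide_distrib ceiling_unique) linarith
    moreover have "card (level (k - 1 + 2)) = card (level (k - 1 + 1))"
      using k n by (intro card_middle_levels(1)) auto
    ultimately show ?thesis using k n by simp
  qed
  moreover have "card (level 2) = card (level 1)" if "n = 3"
    using card_middle_levels(1)[of 0] that by (simp flip: numeral_2_eq_2)
  ultimately show "free F \<and> card F = card (level (n div 2))"
    using free_level free_family1 free_family2 card_family1(1) card_family2(1) by auto
qed

end

text \<open>For n = 1 the chain of {0} and the whole space has 2 members against a binomial of 1,
  and for n = q = 2 a full flag has as many members as there are points; the conditions on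
  \<open>n\<close> and \<open>q\<close> keep these cases out.\<close>

theorem theorem3:
  fixes scale :: "'a::{field,finite} \<Rightarrow> 'b::ab_group_add \<Rightarrow> 'b"
    and q n :: nat
  assumes "vector_space scale"
    and "primepow q" and "card (UNIV :: 'a set) = q"
    and "n \<ge> 2" and "vector_space.dim scale (UNIV :: 'b set) = n"
  shows
    "real (La_star scale {V_poset, Lambda_poset}) = qbinomial q n (n div 2)
     \<and>
     ((n, q) \<noteq> (2, 2) \<longrightarrow>
       (\<forall>F. extremal_family scale {V_poset, Lambda_poset} F \<longleftrightarrow>
          F = subspaces_of_dim scale (n div 2) \<or>
          F = subspaces_of_dim scale (nat \<lceil>real n / 2\<rceil>) \<or>
          n = 3 \<and> q = 2 \<and>
            (\<exists>a\<in>subspaces_of_dim scale 1.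
             \<exists>b\<in>subspaces_of_dim scale 1.
             \<exists>c\<in>subspaces_of_dim scale 1.
               a + b + c = UNIV \<and>
               (F = extra_family1 scale a b c \<or>
                F = extra_family2 scale a b c))))
     \<and>
     (n = 3 \<and> q = 2 \<longrightarrow>
       (let E = {F. extremal_family scale {V_poset, Lambda_poset} F}
                - {subspaces_of_dim scale 1, subspaces_of_dim scale 2} in
        \<forall>a\<in>subspaces_of_dim scale 1.
        \<forall>b\<in>subspaces_of_dim scale 1.
        \<forall>c\<in>subspaces_of_dim scale 1.
          a + b + c = UNIV \<longrightarrow>
            extra_family1 scale a b c \<in> E \<and>
            extra_family2 scale a b c \<in> E \<and>
            \<not> equivalent_families scale (extra_family1 scale a b c) (extra_family2 scale a b c) \<and>
            (\<forall>F\<in>E. equivalent_families scale (extra_family1 scale a b c) F \<or>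
                  equivalent_families scale (extra_family2 scale a b c) F)))"
proof -
  interpret vector_space scale by fact
  obtain Basis where Basis: "independent Basis" "UNIV \<subseteq> span Basis" "card Basis = dim UNIV"
    by (rule basis_exists[of UNIV])
  \<comment> \<open>An infinite set has \<open>card\<close> 0, whereas the dimension is at least
    2.\<close>
  have "finite Basis" using Basis(3) assms(4,5) card.infinite by fastforce
  interpret finite_geometry scale Basis q n
    by unfold_locales (use Basis \<open>finite Basis\<close> assms in auto)
  show ?thesis
  proof (intro conjI impI)
    show "real (La_star scale {V_poset, Lambda_poset}) = qbinomial q n (n div 2)"
      using La_star_eq card_level_qbinomial[of "n div 2"] assms(4) by simp
  next
    assume "(n, q) \<noteq> (2, 2)"
    then show "\<forall>F. extremal_family scale {V_poset, Lambda_poset} F \<longleftrightarrow>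
          F = subspaces_of_dim scale (n div 2) \<or>
          F = subspaces_of_dim scale (nat \<lceil>real n / 2\<rceil>) \<or>
          n = 3 \<and> q = 2 \<and>
            (\<exists>a\<in>subspaces_of_dim scale 1.
             \<exists>b\<in>subspaces_of_dim scale 1.
             \<exists>c\<in>subspaces_of_dim scale 1.
               a + b + c = UNIV \<and>
               (F = extra_family1 scale a b c \<or>
                F = extra_family2 scale a b c))"
      using extremal_characterization[OF assms(4)] unfolding triangle_def by metis
  next
    assume nq: "n = 3 \<and> q = 2"
    let ?E = "{F. extremal_family scale {V_poset, Lambda_poset} F} - {level 1, level 2}"
    have ch: "extremal_family scale {V_poset, Lambda_poset} F \<longleftrightarrow> F = level 1 \<or> F = level 2 \<or>
      (\<exists>a b c. triangle a b c \<and> (F = family1 a b c \<or> F = family2 a b c))" for F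
    proof -
      have "nat \<lceil>real n / 2\<rceil> = 2" using nq by simp
      then show ?thesis using extremal_characterization[OF assms(4), of F] nq by simp
    qed
    have c7: "card (level 1) = 7"
      using projective_plane.card_points[OF plane_rank3] nq by simp
    have "level 2 \<inter> level 1 = {}" by (auto simp: level_iff)
    then have c0: "card (level 2 \<inter> level 1) = 0" by simp
    have "family1 a b c \<in> ?E \<and> family2 a b c \<in> ?E \<and>
        \<not> equivalent_families scale (family1 a b c) (family2 a b c) \<and>
        (\<forall>F\<in>?E. equivalent_families scale (family1 a b c) F \<or> equivalent_families scale (family2 a b c) F)"
      if t: "triangle a b c" for a b c
    proof (intro conjI ballI)
      \<comment> \<open>The numbers of points, 4 and 3, also differ from 7 and 0, those of the two
        full levels.\<close>
      have "card (family1 a b c \<inter> level 1) = 4" "card (family2 a b c \<inter> level 1) = 3"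
        using card_family1(2)[OF _ t] card_family2(2)[OF _ t] nq c7 by auto
      then have "family1 a b c \<noteq> level 1" "family1 a b c \<noteq> level 2"
        "family2 a b c \<noteq> level 1" "family2 a b c \<noteq> level 2"
        using c7 c0 by auto
      then show "family1 a b c \<in> ?E" "family2 a b c \<in> ?E" using ch t by auto
      show "\<not> equivalent_families scale (family1 a b c) (family2 a b c)"
        using families_not_equivalent nq t by blast
      fix F assume "F \<in> ?E"
      then obtain a' b' c' where "triangle a' b' c'" "F = family1 a' b' c' \<or> F = family2 a' b' c'"
        using ch by blast
      then show "equivalent_families scale (family1 a b c) F \<or> equivalent_families scale (family2 a b c) F"
        using equivalent_triangle_families[OF _ t] nq by blast
    qed
    then show "let E = {F. extremal_family scale {V_poset, Lambda_poset} F}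
                - {subspaces_of_dim scale 1, subspaces_of_dim scale 2} in
        \<forall>a\<in>subspaces_of_dim scale 1.
        \<forall>b\<in>subspaces_of_dim scale 1.
        \<forall>c\<in>subspaces_of_dim scale 1.
          a + b + c = UNIV \<longrightarrow>
            extra_family1 scale a b c \<in> E \<and>
            extra_family2 scale a b c \<in> E \<and>
            \<not> equivalent_families scale (extra_family1 scale a b c) (extra_family2 scale a b c) \<and>
            (\<forall>F\<in>E. equivalent_families scale (extra_family1 scale a b c) F \<or>
                  equivalent_families scale (extra_family2 scale a b c) F)"
      unfolding Let_def triangle_def by blast
  qed
qed

end
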